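(* Let $n\in\mathbb{N}$, let $-1<y_1<y_2<\cdots<y_N<1$ be snapshot points and $\{w_i\}_{i=1}^N\subset\mathbb{R}_+$ positive weights such that $(g,f)_D:=\sum_{i=1}^N g(y_i)f(y_i)w_i$ is an inner product on $\mathcal{P}^n([-1,1])$ and $\sum_{i=1}^N w_i=2$. Let $h=\max_{i\in\{1,\ldots,N\}}|I_i|$, where $$I_1=\left(-1,\tfrac{y_1+y_2}{2}\right],\quad I_i=\left[\tfrac{y_{i-1}+y_i}{2},\tfrac{y_i+y_{i+1}}{2}\right]\ (2\le i\le N-1),\quad I_N=\left[\tfrac{y_{N-1}+y_N}{2},1\right).$$ Assume that $2C_{\rm inv}hn^2<1$. Let $x(y)\in\mathbb{R}^m$ be the solution to $A(y)x(y)=b$ for $y\in(-1,1)$, with $b\neq0$, and let $\tilde x(y)$ be the subspace solution from the Lagrange subspace $V(\{y_i\}_{i=1}^N)=\mathrm{span}\{x(y_1),\ldots,x(y_N)\}$. Then $$\frac{\|x-\tilde x\|_{L^2(-1,1;\mathbb{R}^m_{A_0})}}{\|x(0)\|_{A_0}}\le\kappa\left(\sqrt2+\frac{\sqrt{2(n+1)}}{1-2C_{\rm inv}hn^2}\right)\frac{4}{r^2}(1-r)^{n+1},$$ where $\kappa=\left(\frac{1+C}{r}\right)^{1/2}$.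
   Context: Model problem. $\Omega\subset\mathbb{R}^d$, $d\in\{2,3\}$, is a domain with Lipschitz boundary; $L:H^1_0(\Omega)\to\mathbb{R}$ is a bounded linear functional; $a_0,a_1:H^1_0(\Omega)\times H^1_0(\Omega)\to\mathbb{R}$ are symmetric continuous bilinear forms, $a_0$ is coercive, $a_1$ is positive semidefinite, and $0<r<1$ is such that $a_1(v,v)\le(1-r)a_0(v,v)$ for all $v\in H^1_0(\Omega)$. $C>0$ is a constant such that $|a_1(v,z)|\le C\,a_0(v,v)^{1/2}a_0(z,z)^{1/2}$ for all $v,z\in H^1_0(\Omega)$. $X_h\subset H^1_0(\Omega)$ is a finite-dimensional (finite element) subspace with basis $\{\varphi_i\}_{i=1}^m$. Define $A_0,A_1\in\mathbb{R}^{m\times m}$ by $[A_0]_{ij}=a_0(\varphi_i,\varphi_j)$, $[A_1]_{ij}=a_1(\varphi_i,\varphi_j)$, set $A(y)=A_0+yA_1$ for $y\in(-1,1)$, and $b\in\mathbb{R}^m$, $b_i=L(\varphi_i)$. The matrices $A_0$ and $A(y)$ are symmetric positive definite. Subspace solution. For a subspace $V\subset\mathbb{R}^m$ with basis matrix $Q\in\mathbb{R}^{m\times k}$ (columns of $Q$ form a basis of $V$), the subspace solution of $A(y)x(y)=b$ from $V$ is $\tilde x(y)=Qz(y)$, where $Q^TA(y)Qz(y)=Q^Tb$. Norms and constants. $\|z\|_{A_0}=(z^TA_0z)^{1/2}$, and $\mathbb{R}^m_{A_0}$ is $\mathbb{R}^m$ with this norm; $\|f\|_{L^2(-1,1;\mathbb{R}^m_{A_0})}=\left(\int_{-1}^1\|f(y)\|_{A_0}^2\,dy\right)^{1/2}$.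 $\mathcal{P}^n([-1,1])$ is the space of real polynomials of degree at most $n$ on $[-1,1]$. $C_{\rm inv}>0$ is a constant, independent of $n$ and $q$, for which the inverse inequality $\|q'\|_{L^2(-1,1)}\le C_{\rm inv}n^2\|q\|_{L^2(-1,1)}$ holds for all $n\in\mathbb{N}$ and $q\in\mathcal{P}^n([-1,1])$ (such a constant exists). $N\ge2$. *)

theory Defs
  imports "HOL-Analysis.Analysis" "HOL-Computational_Algebra.Polynomial"
begin

section \<open>Square-integrable functions\<close>

text \<open>The values are measured by \<open>\<nu>\<close>, which is \<open>abs\<close>, \<open>norm\<close>, or the energy norm of a matrix.
  Functions are not identified when they agree almost everywhere.\<close>

definition L2_space :: "'a measure \<Rightarrow> ('b::topological_space \<Rightarrow> real) \<Rightarrow> ('a \<Rightarrow> 'b) set" where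
  "L2_space M \<nu> = {f \<in> borel_measurable M. integrable M (\<lambda>x. (\<nu> (f x))\<^sup>2)}"

definition L2_norm :: "'a measure \<Rightarrow> ('b \<Rightarrow> real) \<Rightarrow> ('a \<Rightarrow> 'b) \<Rightarrow> real" where
  "L2_norm M \<nu> f = sqrt (LINT x|M. (\<nu> (f x))\<^sup>2)"

section \<open>The Sobolev space of functions with zero trace\<close>

text \<open>Near every boundary point the open set is, along some direction \<open>e\<close>, the region strictly
  above the graph of a Lipschitz function \<open>g\<close> on the hyperplane orthogonal to \<open>e\<close>; only the values
  of \<open>g\<close> on that hyperplane are used.\<close>

definition Lipschitz_boundary :: "'a::euclidean_space set \<Rightarrow> bool" where
  "Lipschitz_boundary \<Omega> \<longleftrightarrow>
     (\<forall>p\<in>frontier \<Omega>. \<exists>\<rho>>0. \<exists>e (g::'a \<Rightarrow> real) K. norm e = 1 \<and> K-lipschitz_on UNIV g \<and>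
        \<Omega> \<inter> ball p \<rho> = {z \<in> ball p \<rho>. g (z - (z \<bullet> e) *\<^sub>R e) < z \<bullet> e})"

definition Lipschitz_domain :: "'a::euclidean_space set \<Rightarrow> bool" where
  "Lipschitz_domain \<Omega> \<longleftrightarrow> open \<Omega> \<and> connected \<Omega> \<and> \<Omega> \<noteq> {} \<and> Lipschitz_boundary \<Omega>"

primrec C_k :: "nat \<Rightarrow> (real^'d \<Rightarrow> real) \<Rightarrow> bool" where
  "C_k 0 f \<longleftrightarrow> continuous_on UNIV f"
| "C_k (Suc k) f \<longleftrightarrow> (\<exists>g. (\<forall>x. GDERIV f x :> g x) \<and> (\<forall>i. C_k k (\<lambda>x. g x $ i)))"

definition test_functions :: "(real^'d) set \<Rightarrow> (real^'d \<Rightarrow> real) set" where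
  "test_functions \<Omega> = {\<psi>. (\<forall>k. C_k k \<psi>) \<and>
     compact (closure {x. \<psi> x \<noteq> 0}) \<and> closure {x. \<psi> x \<noteq> 0} \<subseteq> \<Omega>}"

definition has_weak_gradient ::
    "(real^'d) set \<Rightarrow> (real^'d \<Rightarrow> real) \<Rightarrow> (real^'d \<Rightarrow> real^'d) \<Rightarrow> bool" where
  "has_weak_gradient \<Omega> u g \<longleftrightarrow>
     (\<forall>\<psi>\<in>test_functions \<Omega>. \<forall>D. (\<forall>x. GDERIV \<psi> x :> D x) \<longrightarrow>
        (LINT x|lebesgue_on \<Omega>. u x *\<^sub>R D x) = - (LINT x|lebesgue_on \<Omega>. \<psi> x *\<^sub>R g x))"

definition H1 :: "(real^'d) set \<Rightarrow> (real^'d \<Rightarrow> real) set" where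
  "H1 \<Omega> = {u \<in> L2_space (lebesgue_on \<Omega>) abs.
     \<exists>g\<in>L2_space (lebesgue_on \<Omega>) norm. has_weak_gradient \<Omega> u g}"

text \<open>Weak gradients are unique up to null sets, so \<open>H1_norm\<close> does not depend on this choice.\<close>

definition weak_gradient :: "(real^'d) set \<Rightarrow> (real^'d \<Rightarrow> real) \<Rightarrow> real^'d \<Rightarrow> real^'d" where
  "weak_gradient \<Omega> u = (SOME g. g \<in> L2_space (lebesgue_on \<Omega>) norm \<and> has_weak_gradient \<Omega> u g)"

definition H1_norm :: "(real^'d) set \<Rightarrow> (real^'d \<Rightarrow> real) \<Rightarrow> real" where
  "H1_norm \<Omega> u = sqrt ((L2_norm (lebesgue_on \<Omega>) abs u)\<^sup>2 +
                       (L2_norm (lebesgue_on \<Omega>) norm (weak_gradient \<Omega> u))\<^sup>2)"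

definition H10 :: "(real^'d) set \<Rightarrow> (real^'d \<Rightarrow> real) set" where
  "H10 \<Omega> = {u \<in> H1 \<Omega>. \<exists>\<psi> :: nat \<Rightarrow> real^'d \<Rightarrow> real. (\<forall>k. \<psi> k \<in> test_functions \<Omega>) \<and>
     (\<lambda>k. H1_norm \<Omega> (\<lambda>x. u x - \<psi> k x)) \<longlonglongrightarrow> 0}"

section \<open>Functionals, bilinear forms and finite-dimensional subspaces\<close>

text \<open>The functionals and forms act on functions rather than on classes; boundedness makes them
  compatible with equality almost everywhere.\<close>

definition bounded_functional_on ::
    "('a \<Rightarrow> real) set \<Rightarrow> (('a \<Rightarrow> real) \<Rightarrow> real) \<Rightarrow> (('a \<Rightarrow> real) \<Rightarrow> real) \<Rightarrow> bool" where
  "bounded_functional_on H \<nu> L \<longleftrightarrow>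
     (\<forall>u\<in>H. \<forall>v\<in>H. L (\<lambda>x. u x + v x) = L u + L v) \<and>
     (\<forall>u\<in>H. \<forall>c. L (\<lambda>x. c * u x) = c * L u) \<and>
     (\<exists>K. \<forall>u\<in>H. \<bar>L u\<bar> \<le> K * \<nu> u)"

definition symmetric_bilinear_on ::
    "('a \<Rightarrow> real) set \<Rightarrow> (('a \<Rightarrow> real) \<Rightarrow> ('a \<Rightarrow> real) \<Rightarrow> real) \<Rightarrow> bool" where
  "symmetric_bilinear_on H a \<longleftrightarrow>
     (\<forall>u\<in>H. \<forall>v\<in>H. a u v = a v u) \<and>
     (\<forall>u\<in>H. \<forall>v\<in>H. \<forall>z\<in>H. a (\<lambda>x. u x + v x) z = a u z + a v z) \<and>
     (\<forall>u\<in>H. \<forall>z\<in>H. \<forall>c. a (\<lambda>x. c * u x) z = c * a u z)"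

definition continuous_form_on ::
    "('a \<Rightarrow> real) set \<Rightarrow> (('a \<Rightarrow> real) \<Rightarrow> real) \<Rightarrow> (('a \<Rightarrow> real) \<Rightarrow> ('a \<Rightarrow> real) \<Rightarrow> real) \<Rightarrow> bool" where
  "continuous_form_on H \<nu> a \<longleftrightarrow> (\<exists>K. \<forall>u\<in>H. \<forall>v\<in>H. \<bar>a u v\<bar> \<le> K * \<nu> u * \<nu> v)"

definition coercive_on ::
    "('a \<Rightarrow> real) set \<Rightarrow> (('a \<Rightarrow> real) \<Rightarrow> real) \<Rightarrow> (('a \<Rightarrow> real) \<Rightarrow> ('a \<Rightarrow> real) \<Rightarrow> real) \<Rightarrow> bool" where
  "coercive_on H \<nu> a \<longleftrightarrow> (\<exists>\<alpha>>0. \<forall>u\<in>H. \<alpha> * (\<nu> u)\<^sup>2 \<le> a u u)"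

definition function_subspace :: "('a \<Rightarrow> real) set \<Rightarrow> bool" where
  "function_subspace X \<longleftrightarrow> (\<lambda>_. 0) \<in> X \<and>
     (\<forall>u\<in>X. \<forall>v\<in>X. (\<lambda>x. u x + v x) \<in> X) \<and> (\<forall>u\<in>X. \<forall>c. (\<lambda>x. c * u x) \<in> X)"

text \<open>Independence and spanning are understood up to equality almost everywhere.\<close>

definition function_basis ::
    "'a measure \<Rightarrow> ('a \<Rightarrow> real) set \<Rightarrow> ('m::finite \<Rightarrow> 'a \<Rightarrow> real) \<Rightarrow> bool" where
  "function_basis M X \<phi> \<longleftrightarrow>
     (\<forall>i. \<phi> i \<in> X) \<and>
     (\<forall>c. (AE x in M. (\<Sum>i\<in>UNIV. c i * \<phi> i x) = 0) \<longrightarrow> (\<forall>i. c i = 0)) \<and>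
     (\<forall>u\<in>X. \<exists>c. AE x in M. u x = (\<Sum>i\<in>UNIV. c i * \<phi> i x))"

section \<open>The parametric linear system and its subspace solutions\<close>

definition form_matrix ::
    "(('a \<Rightarrow> real) \<Rightarrow> ('a \<Rightarrow> real) \<Rightarrow> real) \<Rightarrow> ('m \<Rightarrow> 'a \<Rightarrow> real) \<Rightarrow> real^'m^'m" where
  "form_matrix a \<phi> = (\<chi> i j. a (\<phi> i) (\<phi> j))"

definition load_vector :: "(('a \<Rightarrow> real) \<Rightarrow> real) \<Rightarrow> ('m \<Rightarrow> 'a \<Rightarrow> real) \<Rightarrow> real^'m" where
  "load_vector L \<phi> = (\<chi> i. L (\<phi> i))"

definition energy_norm :: "real^'m^'m \<Rightarrow> real^'m \<Rightarrow> real" where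
  "energy_norm A z = sqrt (z \<bullet> (A *v z))"

definition basis_matrix :: "real^'k^'m \<Rightarrow> (real^'m) set \<Rightarrow> bool" where
  "basis_matrix Q V \<longleftrightarrow> inj (\<lambda>j. column j Q) \<and> independent (columns Q) \<and> span (columns Q) = V"

definition subspace_solution ::
    "real^'k^'m \<Rightarrow> real^'m^'m \<Rightarrow> real^'m \<Rightarrow> real^'m \<Rightarrow> bool" where
  "subspace_solution Q A b xt \<longleftrightarrow>
     (\<exists>z. xt = Q *v z \<and> (transpose Q ** A ** Q) *v z = transpose Q *v b)"

section \<open>Snapshot points and discrete inner products\<close>

definition inner_product_on_polys :: "nat \<Rightarrow> (real poly \<Rightarrow> real poly \<Rightarrow> real) \<Rightarrow> bool" where
  "inner_product_on_polys n ip \<longleftrightarrow>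
     (\<forall>p q. degree p \<le> n \<longrightarrow> degree q \<le> n \<longrightarrow> ip p q = ip q p) \<and>
     (\<forall>p q s. degree p \<le> n \<longrightarrow> degree q \<le> n \<longrightarrow> degree s \<le> n \<longrightarrow> ip (p + q) s = ip p s + ip q s) \<and>
     (\<forall>c p s. degree p \<le> n \<longrightarrow> degree s \<le> n \<longrightarrow> ip (smult c p) s = c * ip p s) \<and>
     (\<forall>p. degree p \<le> n \<longrightarrow> p \<noteq> 0 \<longrightarrow> 0 < ip p p)"

definition discrete_product ::
    "nat \<Rightarrow> (nat \<Rightarrow> real) \<Rightarrow> (nat \<Rightarrow> real) \<Rightarrow> real poly \<Rightarrow> real poly \<Rightarrow> real" where
  "discrete_product N ys w g f = (\<Sum>i=1..N. poly g (ys i) * poly f (ys i) * w i)"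

definition snapshot_interval :: "nat \<Rightarrow> (nat \<Rightarrow> real) \<Rightarrow> nat \<Rightarrow> real set" where
  "snapshot_interval N ys i =
     (if i = 1 then {-1<..(ys 1 + ys 2) / 2}
      else if i = N then {(ys (N - 1) + ys N) / 2..<1}
      else {(ys (i - 1) + ys i) / 2..(ys i + ys (i + 1)) / 2})"

definition mesh_size :: "nat \<Rightarrow> (nat \<Rightarrow> real) \<Rightarrow> real" where
  "mesh_size N ys = Max ((\<lambda>i. measure lebesgue (snapshot_interval N ys i)) ` {1..N})"

end

theory Submission
  imports Defs
begin

text \<open>Let \<open>p\<close> be the degree-\<open>n\<close> Taylor polynomial of \<open>x\<close> at \<open>0\<close>, so that
  \<open>\<parallel>x(y) - p(y)\<parallel> \<le> \<epsilon> = (1 - r)\<^sup>n\<^sup>+\<^sup>1 \<parallel>x(0)\<parallel> / r\<close>, and let \<open>P\<close> be the \<open>A\<^sub>0\<close>-orthogonal projection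
  onto the Lagrange subspace. Since \<open>P\<close> fixes every snapshot, the polynomial \<open>u = p - P p\<close>
  satisfies \<open>\<parallel>u(y\<^sub>i)\<parallel> = \<parallel>(I - P)(p(y\<^sub>i) - x(y\<^sub>i))\<parallel> \<le> \<epsilon>\<close>. By the inverse inequality the \<open>L\<^sup>2\<close> norm
  of a polynomial is controlled by its samples weighted with the lengths of the snapshot intervals
  (rather than with \<open>w\<^sub>i\<close>), hence \<open>\<integral> \<parallel>u\<parallel>\<^sup>2 \<le> 8 \<epsilon>\<^sup>2\<close>. Quasi-optimality of the subspace solution
  against the comparison function \<open>P p\<close> gives \<open>\<parallel>x - xt\<parallel> \<le> \<kappa> (\<parallel>x - p\<parallel> + \<parallel>u\<parallel>)\<close> pointwise, so the squared
  error is at most \<open>20 \<kappa>\<^sup>2 \<epsilon>\<^sup>2\<close>, which is below the claimed bound.\<close>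

section \<open>Parametric symmetric positive definite systems\<close>

lemma inner_matrix_symmetric:
  fixes M :: "real^'m^'m"
  assumes "transpose M = M"
  shows "u \<bullet> (M *v v) = v \<bullet> (M *v u)"
  by (metis assms dot_lmul_matrix inner_commute transpose_matrix_vector)

text \<open>The form is nonnegative on the line \<open>u + t v\<close>, so its discriminant as a
  quadratic in \<open>t\<close> is not positive. Semidefiniteness is enough, which lets the bound
  apply to \<open>K\<close> as well as to \<open>M\<close>.\<close>

lemma psd_Cauchy_Schwarz:
  fixes M :: "real^'m^'m"
  assumes sym: "transpose M = M" and psd: "\<And>z. 0 \<le> z \<bullet> (M *v z)"
  shows "(u \<bullet> (M *v v))\<^sup>2 \<le> (u \<bullet> (M *v u)) * (v \<bullet> (M *v v))"
proof -
  define a where "a = u \<bullet> (M *v u)"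
  define b where "b = u \<bullet> (M *v v)"
  define c where "c = v \<bullet> (M *v v)"
  have ba: "v \<bullet> (M *v u) = b"
    unfolding b_def by (rule inner_matrix_symmetric[OF sym])
  have q: "0 \<le> a + 2 * t * b + t\<^sup>2 * c" for t
    using psd[of "u + t *\<^sub>R v"] ba
    by (simp add: a_def b_def c_def matrix_vector_right_distrib matrix_vector_mult_scaleR
        inner_add_left inner_add_right power2_eq_square algebra_simps)
  have c0: "0 \<le> c" unfolding c_def by (rule psd)
  have "b\<^sup>2 \<le> a * c"
  proof (cases "c = 0")
    case True
    have "b = 0"
    proof (rule ccontr)
      assume "b \<noteq> 0"
      \<comment> \<open>For \<open>c = 0\<close> the quadratic is affine in \<open>t\<close>; this
        choice of \<open>t\<close> gives it the value -1.\<close>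
      then have "2 * (- (a + 1) / (2 * b)) * b = - (a + 1)" by simp
      with q[of "- (a + 1) / (2 * b)"] True show False by simp
    qed
    then show ?thesis using True by simp
  next
    case False
    with c0 have "0 < c" by simp
    \<comment> \<open>The quadratic attains its minimum at \<open>t = - b / c\<close>.\<close>
    have "0 \<le> a + 2 * (- b / c) * b + (- b / c)\<^sup>2 * c" by (rule q)
    also have "\<dots> = a - b\<^sup>2 / c" using \<open>0 < c\<close> by (simp add: power2_eq_square field_simps)
    finally show ?thesis using \<open>0 < c\<close> by (simp add: field_simps)
  qed
  then show ?thesis by (simp add: a_def b_def c_def)
qed

section \<open>Orthonormal families and orthogonal projection in the energy inner product\<close>

locale spd_matrix =
  fixes M :: "real^'m^'m"
  assumes sym: "transpose M = M" and pos: "\<And>z. z \<noteq> 0 \<Longrightarrow> 0 < z \<bullet> (M *v z)"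
begin

definition orthonormal :: "(real^'m) set \<Rightarrow> bool" where
  "orthonormal F \<longleftrightarrow> finite F \<and> (\<forall>f\<in>F. \<forall>g\<in>F. f \<bullet> (M *v g) = (if f = g then 1 else 0))"

definition proj :: "(real^'m) set \<Rightarrow> real^'m \<Rightarrow> real^'m" where
  "proj F z = (\<Sum>f\<in>F. (f \<bullet> (M *v z)) *\<^sub>R f)"

lemma nonneg: "0 \<le> z \<bullet> (M *v z)"
  by (cases "z = 0") (auto intro: less_imp_le pos)

lemma commute: "u \<bullet> (M *v v) = v \<bullet> (M *v u)"
  by (rule inner_matrix_symmetric[OF sym])

text \<open>The parallelogram identity with the energy of \<open>u - v\<close> dropped.\<close>

lemma inner_sum_le: "(u + v) \<bullet> (M *v (u + v)) \<le> 2 * (u \<bullet> (M *v u)) + 2 * (v \<bullet> (M *v v))"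
  using nonneg[of "u - v"]
  by (simp add: matrix_vector_right_distrib matrix_vector_mult_diff_distrib inner_diff_left
      inner_diff_right inner_add_left inner_add_right)

lemma linear_proj: "linear (proj F)"
  unfolding proj_def
  by (intro linearI) (simp_all add: matrix_vector_right_distrib matrix_vector_mult_scaleR inner_add_right
      scaleR_add_left sum.distrib scaleR_sum_right)

lemma proj_in_span: "proj F z \<in> span F"
  unfolding proj_def by (intro span_sum span_mul span_base)

lemma inner_proj:
  assumes "orthonormal F" "f \<in> F"
  shows "f \<bullet> (M *v proj F z) = f \<bullet> (M *v z)"
proof -
  have "f \<bullet> (M *v proj F z) = (\<Sum>g\<in>F. (g \<bullet> (M *v z)) * (f \<bullet> (M *v g)))"
    unfolding proj_def
    by (simp add: linear_sum[OF matrix_vector_mul_linear] matrix_vector_mult_scaleR inner_sum_right)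
  also have "\<dots> = (\<Sum>g\<in>F. if g = f then f \<bullet> (M *v z) else 0)"
    using assms by (intro sum.cong) (auto simp: orthonormal_def)
  also have "\<dots> = f \<bullet> (M *v z)"
    using assms by (simp add: orthonormal_def)
  finally show ?thesis .
qed

text \<open>The difference \<open>z - proj F z\<close> lies in \<open>span F\<close> and is
  energy-orthogonal to \<open>span F\<close>, hence to itself.\<close>

lemma proj_id:
  assumes "orthonormal F" "z \<in> span F"
  shows "proj F z = z"
proof -
  have "z - proj F z \<in> span F"
    using assms(2) proj_in_span by (rule span_diff)
  moreover have "v \<bullet> (M *v (z - proj F z)) = 0" if "v \<in> span F" for v
    using that
  proof (induction rule: span_induct)
    case base
    then show ?case by (simp add: subspace_def inner_add_left)
  next
    case (step f)
    then show ?case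
      using inner_proj[OF assms(1)] by (simp add: matrix_vector_mult_diff_distrib inner_diff_right)
  qed
  ultimately show ?thesis
    using pos[of "z - proj F z"] by fastforce
qed

text \<open>When \<open>F\<close> spans the space, \<open>proj F z = z\<close> and the first
  equation is Parseval's identity; it will split the energy of a vector polynomial into squares of
  scalar polynomials.\<close>

lemma norm_proj:
  assumes "orthonormal F"
  shows "z \<bullet> (M *v proj F z) = (\<Sum>f\<in>F. (f \<bullet> (M *v z))\<^sup>2)"
    and "proj F z \<bullet> (M *v proj F z) = (\<Sum>f\<in>F. (f \<bullet> (M *v z))\<^sup>2)"
proof -
  have *: "u \<bullet> (M *v proj F z) = (\<Sum>f\<in>F. (f \<bullet> (M *v z)) * (f \<bullet> (M *v u)))" for u
    by (subst commute) (simp add: proj_def inner_sum_left)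
  show "z \<bullet> (M *v proj F z) = (\<Sum>f\<in>F. (f \<bullet> (M *v z))\<^sup>2)"
    by (simp add: * power2_eq_square)
  show "proj F z \<bullet> (M *v proj F z) = (\<Sum>f\<in>F. (f \<bullet> (M *v z))\<^sup>2)"
    by (subst *, intro sum.cong) (simp_all add: inner_proj[OF assms] power2_eq_square)
qed

text \<open>Pythagoras: removing the projection removes its energy.\<close>

lemma norm_diff_proj_le:
  assumes "orthonormal F"
  shows "(z - proj F z) \<bullet> (M *v (z - proj F z)) \<le> z \<bullet> (M *v z)"
proof -
  have "(z - proj F z) \<bullet> (M *v (z - proj F z)) = z \<bullet> (M *v z) - proj F z \<bullet> (M *v proj F z)"
    using norm_proj[OF assms, of z] commute[of z "proj F z"]
    by (simp add: matrix_vector_mult_diff_distrib inner_diff_left inner_diff_right)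
  then show ?thesis using nonneg[of "proj F z"] by simp
qed

text \<open>Gram-Schmidt in the energy inner product. A vector whose residual \<open>d\<close>
  vanishes adds nothing to the family.\<close>

lemma ex_orthonormal:
  assumes "finite E"
  shows "\<exists>F. orthonormal F \<and> span F = span E"
  using assms
proof (induction E rule: finite_induct)
  case empty
  show ?case by (rule exI[of _ "{}"]) (simp add: orthonormal_def)
next
  case (insert a E)
  then obtain F where F: "orthonormal F" "span F = span E" by blast
  define d where "d = a - proj F a"
  have d: "span (insert d F) = span (insert a E)"
  proof -
    have "d - a \<in> span F"
      using span_neg[OF proj_in_span[of F a]] by (simp add: d_def)
    then have "span (insert d F) = span (insert a F)" by (rule eq_span_insert_eq)
    then show ?thesis using F(2) by (simp add: span_insert)
  qed
  show ?case
  proof (cases "d = 0")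
    case True
    then show ?thesis using F(1) d by (auto simp: span_insert_0)
  next
    case False
    define c where "c = 1 / sqrt (d \<bullet> (M *v d))"
    define e where "e = c *\<^sub>R d"
    have c: "c \<noteq> 0" and cc: "c * c * (d \<bullet> (M *v d)) = 1"
      using pos[OF False] by (simp_all add: c_def)
    have e1: "e \<bullet> (M *v e) = 1"
      using cc by (simp add: e_def matrix_vector_mult_scaleR mult.assoc)
    have e0: "f \<bullet> (M *v e) = 0" if "f \<in> F" for f
      using inner_proj[OF F(1) that, of a]
      by (simp add: e_def d_def matrix_vector_mult_scaleR matrix_vector_mult_diff_distrib
          inner_diff_right)
    have "orthonormal (insert e F)"
    proof -
      have "e \<bullet> (M *v f) = 0" if "f \<in> F" for f using e0[OF that] commute[of e f] by simp
      moreover have "e \<notin> F" using e0[of e] e1 by auto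
      ultimately show ?thesis using F(1) e0 e1 by (auto simp: orthonormal_def)
    qed
    moreover have "span (insert e F) = span (insert d F)"
    proof (rule span_eq[THEN iffD2], intro conjI)
      show "insert e F \<subseteq> span (insert d F)"
        by (auto simp: e_def intro: span_mul span_base)
      have "d = (1 / c) *\<^sub>R e" using c by (simp add: e_def)
      then have "d \<in> span (insert e F)" by (metis insertI1 span_base span_mul)
      then show "insert d F \<subseteq> span (insert e F)" by (auto intro: span_base)
    qed
    ultimately show ?thesis using d by auto
  qed
qed

end

text \<open>\<open>M\<close> and \<open>K\<close> play the roles of \<open>A\<^sub>0\<close> and \<open>A\<^sub>1\<close>.\<close>

locale affine_spd = spd_matrix M for M :: "real^'m^'m" +
  fixes K :: "real^'m^'m" and r :: real
  assumes K_sym: "transpose K = K" and K_nonneg: "\<And>z. 0 \<le> z \<bullet> (K *v z)"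
    and K_le: "\<And>z. z \<bullet> (K *v z) \<le> (1 - r) * (z \<bullet> (M *v z))"
    and r_pos: "0 < r" and r_less: "r < 1"
begin

section \<open>Stability, continuity in the parameter and quasi-optimality of Galerkin
  solutions\<close>

lemma inner_system:
  "u \<bullet> ((M + y *\<^sub>R K) *v v) = u \<bullet> (M *v v) + y * (u \<bullet> (K *v v))"
  by (simp add: matrix_vector_mult_add_rdistrib scaleR_matrix_vector_assoc[symmetric] inner_add_right)

text \<open>Since \<open>K\<close> is nonnegative, the worst case is \<open>y\<close> close to -1,
  and there \<open>M - K\<close> still dominates \<open>r M\<close>.\<close>

lemma coercive:
  assumes "\<bar>y\<bar> < 1"
  shows "r * (z \<bullet> (M *v z)) \<le> z \<bullet> ((M + y *\<^sub>R K) *v z)"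
proof -
  have "- (z \<bullet> (K *v z)) \<le> y * (z \<bullet> (K *v z))"
    using mult_right_mono[of "-1" y "z \<bullet> (K *v z)"] assms K_nonneg[of z] by auto
  then show ?thesis unfolding inner_system using K_le[of z] by (simp add: left_diff_distrib)
qed

text \<open>Cauchy-Schwarz for \<open>K\<close>, then \<open>K \<le> (1 - r) M\<close> in each
  factor. This is the source of one factor \<open>1 - r\<close> per term of the Neumann
  series.\<close>

lemma K_Cauchy_Schwarz:
  "(u \<bullet> (K *v v))\<^sup>2 \<le> (1 - r)\<^sup>2 * (u \<bullet> (M *v u)) * (v \<bullet> (M *v v))"
proof -
  have "(u \<bullet> (K *v v))\<^sup>2 \<le> (u \<bullet> (K *v u)) * (v \<bullet> (K *v v))"
    by (rule psd_Cauchy_Schwarz[OF K_sym K_nonneg])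
  also have "\<dots> \<le> ((1 - r) * (u \<bullet> (M *v u))) * ((1 - r) * (v \<bullet> (M *v v)))"
    using r_less by (intro mult_mono K_le K_nonneg mult_nonneg_nonneg nonneg) auto
  finally show ?thesis by (simp add: power2_eq_square algebra_simps)
qed

text \<open>With \<open>W = UNIV\<close> this is the full system, with \<open>W\<close> the Lagrange subspace its subspace solution.\<close>

definition galerkin :: "(real^'m) set \<Rightarrow> real^'m \<Rightarrow> real \<Rightarrow> real^'m \<Rightarrow> bool" where
  "galerkin W b y u \<longleftrightarrow> u \<in> W \<and> (\<forall>v\<in>W. v \<bullet> ((M + y *\<^sub>R K) *v u) = v \<bullet> b)"

text \<open>Test the equation with \<open>u\<close> itself. Writing the load as
  \<open>M *v c\<close> makes the right-hand side an energy inner product, to which Cauchy-Schwarz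
  applies.\<close>

lemma galerkin_bound:
  assumes "galerkin W (M *v c) y u" "\<bar>y\<bar> < 1"
  shows "u \<bullet> (M *v u) \<le> (c \<bullet> (M *v c)) / r\<^sup>2"
proof -
  define q where "q = u \<bullet> (M *v u)"
  have q0: "0 \<le> q" unfolding q_def by (rule nonneg)
  have "r * q \<le> u \<bullet> (M *v c)"
    using coercive[OF assms(2), of u] assms(1) by (auto simp: galerkin_def q_def)
  then have "(r * q)\<^sup>2 \<le> (u \<bullet> (M *v c))\<^sup>2"
    using q0 r_pos by (intro power_mono) auto
  also have "\<dots> \<le> q * (c \<bullet> (M *v c))"
    unfolding q_def by (rule psd_Cauchy_Schwarz[OF sym nonneg])
  finally have "q * (r\<^sup>2 * q) \<le> q * (c \<bullet> (M *v c))" by (simp add: power2_eq_square algebra_simps)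
  then have "r\<^sup>2 * q \<le> c \<bullet> (M *v c)"
    using q0 nonneg[of c] by (cases "q = 0") auto
  then show ?thesis using r_pos by (simp add: q_def field_simps)
qed

text \<open>The two equations, both tested with \<open>e = u - v\<close>, differ only through the
  parameter, so the energy of \<open>e\<close> is controlled by \<open>(s - y)\<close> times a
  \<open>K\<close> product. It yields continuity, and with it measurability, of the
  solutions.\<close>

lemma galerkin_Lipschitz:
  assumes W: "subspace W" and "galerkin W b y u" "galerkin W b s v" "\<bar>y\<bar> < 1"
  shows "r\<^sup>2 * ((u - v) \<bullet> (M *v (u - v))) \<le> (y - s)\<^sup>2 * (v \<bullet> (M *v v))"
proof -
  define e where "e = u - v"
  define q where "q = e \<bullet> (M *v e)"
  have q0: "0 \<le> q" unfolding q_def by (rule nonneg)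
  have "e \<in> W" using assms by (auto simp: e_def galerkin_def intro: subspace_diff)
  then have "e \<bullet> ((M + y *\<^sub>R K) *v u) = e \<bullet> ((M + s *\<^sub>R K) *v v)"
    using assms by (simp add: galerkin_def)
  then have *: "e \<bullet> ((M + y *\<^sub>R K) *v e) = (s - y) * (e \<bullet> (K *v v))"
    unfolding inner_system
    by (subst (2 4) e_def) (simp add: matrix_vector_mult_diff_distrib inner_diff_right
        right_diff_distrib left_diff_distrib)
  have "r * q \<le> (s - y) * (e \<bullet> (K *v v))"
    using coercive[OF \<open>\<bar>y\<bar> < 1\<close>, of e] * by (simp add: q_def)
  then have "(r * q)\<^sup>2 \<le> ((s - y) * (e \<bullet> (K *v v)))\<^sup>2"
    using q0 r_pos by (intro power_mono) auto
  also have "\<dots> \<le> (s - y)\<^sup>2 * ((1 - r)\<^sup>2 * q * (v \<bullet> (M *v v)))"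
    unfolding power_mult_distrib q_def by (intro mult_left_mono K_Cauchy_Schwarz) auto
  also have "\<dots> \<le> (s - y)\<^sup>2 * (1 * q * (v \<bullet> (M *v v)))"
    using r_pos r_less q0 nonneg[of v]
    by (intro mult_left_mono mult_right_mono) (auto simp: power_le_one)
  finally have "q * (r\<^sup>2 * q) \<le> q * ((y - s)\<^sup>2 * (v \<bullet> (M *v v)))"
    by (simp add: power2_eq_square algebra_simps)
  then have "r\<^sup>2 * q \<le> (y - s)\<^sup>2 * (v \<bullet> (M *v v))"
    using q0 nonneg[of v] by (cases "q = 0") auto
  then show ?thesis by (simp add: q_def e_def)
qed

text \<open>Cea's argument: Galerkin orthogonality gives Pythagoras in the inner product of
  \<open>M + y K\<close>, so \<open>u\<close> is the best approximation there. Passing to the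
  \<open>M\<close> energy costs \<open>r\<close> from below and \<open>1 + C\<close> from
  above.\<close>

lemma galerkin_quasi_optimal:
  assumes W: "subspace W" and x: "galerkin UNIV b y x" and u: "galerkin W b y u"
    and "\<bar>y\<bar> < 1" "v \<in> W"
    and C: "\<And>z. \<bar>z \<bullet> (K *v z)\<bar> \<le> C * (z \<bullet> (M *v z))"
  shows "(x - u) \<bullet> (M *v (x - u)) \<le> (1 + C) / r * ((x - v) \<bullet> (M *v (x - v)))"
proof -
  let ?S = "M + y *\<^sub>R K"
  have com: "a \<bullet> (?S *v c) = c \<bullet> (?S *v a)" for a c
    unfolding inner_system by (simp add: commute[of a] inner_matrix_symmetric[OF K_sym, of a])
  have "u - v \<in> W" using u \<open>v \<in> W\<close> W by (auto simp: galerkin_def intro: subspace_diff)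
  then have o: "(u - v) \<bullet> (?S *v (x - u)) = 0"
    using x u by (simp add: galerkin_def matrix_vector_mult_diff_distrib inner_diff_right)
  have "((x - u) + (u - v)) \<bullet> (?S *v ((x - u) + (u - v)))
      = (x - u) \<bullet> (?S *v (x - u)) + (u - v) \<bullet> (?S *v (u - v))"
    using o com[of "x - u" "u - v"]
    by (simp only: inner_add_left inner_add_right matrix_vector_right_distrib)
  then have "(x - v) \<bullet> (?S *v (x - v)) = (x - u) \<bullet> (?S *v (x - u)) + (u - v) \<bullet> (?S *v (u - v))"
    by simp
  moreover have "0 \<le> (u - v) \<bullet> (?S *v (u - v))"
    using coercive[OF \<open>\<bar>y\<bar> < 1\<close>, of "u - v"] nonneg[of "u - v"] r_pos
    by (meson mult_nonneg_nonneg less_imp_le order_trans)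
  ultimately have "r * ((x - u) \<bullet> (M *v (x - u))) \<le> (x - v) \<bullet> (?S *v (x - v))"
    using coercive[OF \<open>\<bar>y\<bar> < 1\<close>, of "x - u"] by linarith
  also have "\<dots> \<le> (1 + C) * ((x - v) \<bullet> (M *v (x - v)))"
  proof -
    have "y * ((x - v) \<bullet> (K *v (x - v))) \<le> \<bar>y\<bar> * \<bar>(x - v) \<bullet> (K *v (x - v))\<bar>"
      by (metis abs_ge_self abs_mult)
    also have "\<dots> \<le> 1 * \<bar>(x - v) \<bullet> (K *v (x - v))\<bar>"
      using \<open>\<bar>y\<bar> < 1\<close> by (intro mult_right_mono) auto
    finally show ?thesis using C[of "x - v"] unfolding inner_system by (simp add: distrib_right)
  qed
  finally show ?thesis using r_pos by (simp add: field_simps)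
qed

lemma galerkin_continuous:
  assumes W: "subspace W" and u: "\<And>y. y \<in> {-1<..<1} \<Longrightarrow> galerkin W (M *v c) y (u y)"
  shows "continuous_on {-1<..<1} u"
proof -
  obtain G where G: "orthonormal G" "span G = UNIV"
    using ex_orthonormal[of Basis] by (auto simp: span_Basis)
  \<comment> \<open>One factor \<open>1 / r\<close> comes from the Lipschitz estimate, the other
    from the stability bound on \<open>u s\<close>.\<close>
  define L where "L = sqrt (c \<bullet> (M *v c)) / r\<^sup>2"
  have L0: "0 \<le> L" using nonneg[of c] by (simp add: L_def)
  have "L-lipschitz_on {-1<..<1} (\<lambda>y. g \<bullet> (M *v u y))" if "g \<in> G" for g
  proof (rule lipschitz_onI[OF _ L0])
    fix y s :: real
    assume y: "y \<in> {-1<..<1}" and s: "s \<in> {-1<..<1}"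
    let ?e = "u y - u s"
    have "(g \<bullet> (M *v ?e))\<^sup>2 \<le> (g \<bullet> (M *v g)) * (?e \<bullet> (M *v ?e))"
      by (rule psd_Cauchy_Schwarz[OF sym nonneg])
    also have "\<dots> = ?e \<bullet> (M *v ?e)" using G(1) that by (simp add: orthonormal_def)
    also have "\<dots> \<le> (y - s)\<^sup>2 * (u s \<bullet> (M *v u s)) / r\<^sup>2"
    proof -
      have "\<bar>y\<bar> < 1" using y by auto
      from galerkin_Lipschitz[OF W u[OF y] u[OF s] this] show ?thesis
        using r_pos by (simp add: pos_le_divide_eq mult.commute)
    qed
    also have "\<dots> \<le> (y - s)\<^sup>2 * ((c \<bullet> (M *v c)) / r\<^sup>2) / r\<^sup>2"
      using galerkin_bound[OF u[OF s]] s by (intro divide_right_mono mult_left_mono) auto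
    also have "\<dots> = (L * (y - s))\<^sup>2"
      using nonneg[of c] by (simp add: L_def power_mult_distrib power_divide)
    finally have "\<bar>g \<bullet> (M *v ?e)\<bar> \<le> \<bar>L * (y - s)\<bar>" by (simp only: abs_le_square_iff)
    then show "dist (g \<bullet> (M *v u y)) (g \<bullet> (M *v u s)) \<le> L * dist y s"
      using L0 by (simp add: dist_real_def matrix_vector_mult_diff_distrib inner_diff_right abs_mult)
  qed
  \<comment> \<open>The coordinates in an energy-orthonormal basis are Lipschitz, and
    \<open>u y\<close> is their finite combination.\<close>
  then have "continuous_on {-1<..<1} (\<lambda>y. proj G (u y))"
    unfolding proj_def by (intro continuous_on_sum continuous_on_scaleR continuous_on_const)
      (auto intro: lipschitz_on_continuous_on)
  then show ?thesis using proj_id[OF G(1)] G(2) by simp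
qed

text \<open>Truncating the Neumann series of \<open>(I + y M\<^sup>-\<^sup>1 K)\<^sup>-\<^sup>1\<close> leaves the remainder
  \<open>(- y M\<^sup>-\<^sup>1 K)\<^sup>n\<^sup>+\<^sup>1 x(y)\<close>.\<close>

lemma ex_Taylor:
  "\<exists>c. \<forall>y x. \<bar>y\<bar> < 1 \<longrightarrow> (M + y *\<^sub>R K) *v x = M *v x0 \<longrightarrow>
    (x - (\<Sum>k\<le>n. y ^ k *\<^sub>R c k)) \<bullet> (M *v (x - (\<Sum>k\<le>n. y ^ k *\<^sub>R c k)))
      \<le> ((1 - r) ^ (n + 1) / r)\<^sup>2 * (x0 \<bullet> (M *v x0))"
proof -
  obtain G where G: "orthonormal G" "span G = UNIV"
    using ex_orthonormal[of Basis] by (auto simp: span_Basis)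
  \<comment> \<open>\<open>T\<close> is \<open>M\<^sup>-\<^sup>1 K\<close>, written through its
    expansion in an energy-orthonormal basis.\<close>
  define T where "T z = (\<Sum>g\<in>G. (g \<bullet> (K *v z)) *\<^sub>R g)" for z
  have T: "v \<bullet> (M *v T z) = v \<bullet> (K *v z)" for v z
  proof -
    have "v \<bullet> (M *v T z) = (\<Sum>g\<in>G. (g \<bullet> (K *v z)) * (v \<bullet> (M *v g)))"
      unfolding T_def
      by (simp add: linear_sum[OF matrix_vector_mul_linear] matrix_vector_mult_scaleR inner_sum_right)
    also have "\<dots> = proj G v \<bullet> (K *v z)"
      unfolding proj_def by (simp add: inner_sum_left commute[of v] mult.commute)
    finally show ?thesis using proj_id[OF G(1), of v] G(2) by simp
  qed
  have lin: "linear T"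
    unfolding T_def
    by (intro linearI) (simp_all add: matrix_vector_right_distrib matrix_vector_mult_scaleR
        inner_add_right scaleR_add_left sum.distrib scaleR_sum_right)
  have linp: "linear (T ^^ k)" for k
  proof (induction k)
    case 0
    show ?case by (intro linearI) simp_all
  next
    case (Suc k)
    then show ?case using linear_compose[OF Suc.IH lin] by (simp add: comp_def)
  qed
  \<comment> \<open>Testing with \<open>T z\<close> itself shows that \<open>T\<close> contracts the
    energy norm by \<open>1 - r\<close>.\<close>
  have Tb: "T z \<bullet> (M *v T z) \<le> (1 - r)\<^sup>2 * (z \<bullet> (M *v z))" for z
  proof -
    define q where "q = T z \<bullet> (M *v T z)"
    have q0: "0 \<le> q" unfolding q_def by (rule nonneg)
    have "q\<^sup>2 = (T z \<bullet> (K *v z))\<^sup>2" unfolding q_def T ..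
    also have "\<dots> \<le> (1 - r)\<^sup>2 * q * (z \<bullet> (M *v z))"
      unfolding q_def by (rule K_Cauchy_Schwarz)
    finally have "q * q \<le> q * ((1 - r)\<^sup>2 * (z \<bullet> (M *v z)))"
      by (simp add: power2_eq_square algebra_simps)
    then have "q \<le> (1 - r)\<^sup>2 * (z \<bullet> (M *v z))"
      using q0 nonneg[of z] by (cases "q = 0") auto
    then show ?thesis by (simp add: q_def)
  qed
  have Tpb: "(T ^^ k) z \<bullet> (M *v (T ^^ k) z) \<le> ((1 - r)\<^sup>2) ^ k * (z \<bullet> (M *v z))" for k z
  proof (induction k)
    case (Suc k)
    have "(T ^^ Suc k) z \<bullet> (M *v (T ^^ Suc k) z) \<le> (1 - r)\<^sup>2 * ((T ^^ k) z \<bullet> (M *v (T ^^ k) z))"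
      using Tb[of "(T ^^ k) z"] by simp
    also have "\<dots> \<le> (1 - r)\<^sup>2 * (((1 - r)\<^sup>2) ^ k * (z \<bullet> (M *v z)))"
      by (rule mult_left_mono[OF Suc.IH]) simp
    finally show ?case by (simp add: mult.assoc)
  qed simp
  define c where "c k = (-1) ^ k *\<^sub>R (T ^^ k) x0" for k
  show ?thesis
  proof (intro exI[of _ c] allI impI)
    fix y x
    assume y: "\<bar>y\<bar> < 1" and x: "(M + y *\<^sub>R K) *v x = M *v x0"
    \<comment> \<open>The system multiplied by \<open>M\<^sup>-\<^sup>1\<close>.\<close>
    have xT: "x = x0 - y *\<^sub>R T x"
    proof -
      define e where "e = x - (x0 - y *\<^sub>R T x)"
      have "e \<bullet> (M *v e) = e \<bullet> (M *v x) + y * (e \<bullet> (M *v T x)) - e \<bullet> (M *v x0)"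
        by (subst (2) e_def) (simp add: matrix_vector_mult_diff_distrib
            matrix_vector_mult_scaleR inner_diff_right)
      also have "\<dots> = 0"
        using x inner_system[of e y x] by (simp add: T)
      finally have "e = 0" using pos[of e] by fastforce
      then show ?thesis by (simp add: e_def)
    qed
    \<comment> \<open>Induction step: subtracting the next term replaces \<open>x\<close> by
      \<open>x - x0\<close> under the power of \<open>T\<close>, and \<open>x - x0 = - y T x\<close>
      supplies one more factor \<open>- y T\<close>.\<close>
    have rem: "x - (\<Sum>k\<le>n. y ^ k *\<^sub>R c k) = (- y) ^ (n + 1) *\<^sub>R (T ^^ (n + 1)) x" for n
    proof (induction n)
      case 0
      have "x - x0 = - (y *\<^sub>R T x)" by (subst xT) simp
      then show ?case by (simp add: c_def)
    next
      case (Suc n)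
      have "x - (\<Sum>k\<le>Suc n. y ^ k *\<^sub>R c k)
          = (- y) ^ (n + 1) *\<^sub>R (T ^^ (n + 1)) x - y ^ Suc n *\<^sub>R c (Suc n)"
        using Suc.IH by (simp add: algebra_simps)
      also have "y ^ Suc n *\<^sub>R c (Suc n) = (- y) ^ (n + 1) *\<^sub>R (T ^^ (n + 1)) x0"
        by (simp add: c_def power_minus[of y] mult.commute)
      also have "(- y) ^ (n + 1) *\<^sub>R (T ^^ (n + 1)) x - (- y) ^ (n + 1) *\<^sub>R (T ^^ (n + 1)) x0
          = (- y) ^ (n + 1) *\<^sub>R (T ^^ (n + 1)) (x - x0)"
        by (simp only: linear_diff[OF linp] scaleR_diff_right)
      also have "x - x0 = (- y) *\<^sub>R T x" by (subst xT) simp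
      also have "(T ^^ (n + 1)) ((- y) *\<^sub>R T x) = (- y) *\<^sub>R (T ^^ (Suc n + 1)) x"
        by (subst linear_cmul[OF linp]) (simp add: funpow_swap1)
      finally show ?case by (simp only: scaleR_scaleR) (simp add: mult.commute)
    qed
    have "galerkin UNIV (M *v x0) y x" using x by (simp add: galerkin_def)
    then have xb: "x \<bullet> (M *v x) \<le> (x0 \<bullet> (M *v x0)) / r\<^sup>2" by (rule galerkin_bound) fact
    have "(x - (\<Sum>k\<le>n. y ^ k *\<^sub>R c k)) \<bullet> (M *v (x - (\<Sum>k\<le>n. y ^ k *\<^sub>R c k)))
        = ((- y) ^ (n + 1))\<^sup>2 * ((T ^^ (n + 1)) x \<bullet> (M *v (T ^^ (n + 1)) x))"
      unfolding rem by (simp only: matrix_vector_mult_scaleR inner_scaleR_left inner_scaleR_right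
          power2_eq_square mult.assoc)
    also have "\<dots> \<le> 1 * (((1 - r)\<^sup>2) ^ (n + 1) * (x \<bullet> (M *v x)))"
    proof (intro mult_mono Tpb nonneg)
      have "\<bar>(- y) ^ (n + 1)\<bar> \<le> 1"
        unfolding power_abs using y by (intro power_le_one) auto
      then show "((- y) ^ (n + 1))\<^sup>2 \<le> 1" by (simp only: abs_square_le_1)
    qed auto
    also have "\<dots> \<le> 1 * (((1 - r)\<^sup>2) ^ (n + 1) * ((x0 \<bullet> (M *v x0)) / r\<^sup>2))"
      by (intro mult_left_mono xb) auto
    also have "\<dots> = ((1 - r) ^ (n + 1) / r)\<^sup>2 * (x0 \<bullet> (M *v x0))"
      by (simp add: power_divide power_mult_distrib power_mult[symmetric] mult.commute)
    finally show "(x - (\<Sum>k\<le>n. y ^ k *\<^sub>R c k)) \<bullet> (M *v (x - (\<Sum>k\<le>n. y ^ k *\<^sub>R c k)))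
      \<le> ((1 - r) ^ (n + 1) / r)\<^sup>2 * (x0 \<bullet> (M *v x0))" .
  qed
qed

end

section \<open>Sampling inequality for polynomials\<close>

lemma poly_integrable_on [simp]:
  fixes p :: "real poly"
  shows "poly p integrable_on {a..b}"
  by (intro integrable_continuous_real continuous_intros)

lemma poly_square_integrable_on [simp]:
  fixes p :: "real poly"
  shows "(\<lambda>x. (poly p x)\<^sup>2) integrable_on {a..b}"
  by (intro integrable_continuous_real continuous_intros)

lemma integral_pderiv:
  fixes q :: "real poly"
  assumes "a \<le> b"
  shows "integral {a..b} (poly (pderiv q)) = poly q b - poly q a"
  by (intro integral_unique fundamental_theorem_of_calculus assms)
    (auto simp: has_real_derivative_iff_has_vector_derivative[symmetric]
      intro: poly_DERIV DERIV_subset)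

text \<open>Cauchy-Schwarz for the integral of the derivative, obtained by expanding the nonnegative
  integral of \<open>(q' - l)\<^sup>2\<close>, where \<open>l\<close> is the mean slope.\<close>

lemma poly_increment_square_le:
  fixes q :: "real poly"
  assumes "a \<le> b"
  shows "(poly q b - poly q a)\<^sup>2 \<le> (b - a) * integral {a..b} (\<lambda>x. (poly (pderiv q) x)\<^sup>2)"
proof (cases "a = b")
  case False
  define l where "l = (poly q b - poly q a) / (b - a)"
  have ab: "a < b" using assms False by simp
  let ?p = "pderiv q - [:l:]"
  have "0 \<le> integral {a..b} (\<lambda>x. (poly ?p x)\<^sup>2)"
    by (rule integral_nonneg) (rule poly_square_integrable_on, simp)
  also have "(\<lambda>x. (poly ?p x)\<^sup>2) =
      (\<lambda>x. (poly (pderiv q) x)\<^sup>2 - (2 * l) * poly (pderiv q) x + l\<^sup>2)"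
    by (auto simp: power2_eq_square algebra_simps)
  also have "integral {a..b} \<dots> =
      integral {a..b} (\<lambda>x. (poly (pderiv q) x)\<^sup>2) - (2 * l) * (poly q b - poly q a) + (b - a) * l\<^sup>2"
  proof (rule integral_unique)
    have "(poly (pderiv q) has_integral (poly q b - poly q a)) {a..b}"
      using integral_pderiv[OF assms] integrable_integral[OF poly_integrable_on] by metis
    moreover have "((\<lambda>x. l\<^sup>2) has_integral (b - a) * l\<^sup>2) {a..b}"
      using has_integral_const_real[of "l\<^sup>2" a b] assms by simp
    ultimately show "((\<lambda>x. (poly (pderiv q) x)\<^sup>2 - 2 * l * poly (pderiv q) x + l\<^sup>2) has_integral
        integral {a..b} (\<lambda>x. (poly (pderiv q) x)\<^sup>2) - 2 * l * (poly q b - poly q a) + (b - a) * l\<^sup>2)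
        {a..b}"
      by (intro has_integral_add has_integral_diff has_integral_mult_right
          integrable_integral poly_square_integrable_on)
  qed
  also have "\<dots> = integral {a..b} (\<lambda>x. (poly (pderiv q) x)\<^sup>2) - (poly q b - poly q a)\<^sup>2 / (b - a)"
  proof -
    have "poly q b - poly q a = l * (b - a)" using ab by (simp add: l_def)
    then show ?thesis using ab by (simp add: power2_eq_square)
  qed
  finally show ?thesis using ab by (simp add: field_simps)
qed simp

text \<open>Compare \<open>q\<close> with its value at the sample point; the deviation is controlled
  by the derivative over the whole cell.\<close>

lemma integral_poly_square_cell:
  fixes q :: "real poly"
  assumes "a \<le> s" "s \<le> b"
  shows "integral {a..b} (\<lambda>x. (poly q x)\<^sup>2) \<le>
    2 * (b - a) * (poly q s)\<^sup>2 + 2 * (b - a)\<^sup>2 * integral {a..b} (\<lambda>x. (poly (pderiv q) x)\<^sup>2)"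
proof -
  define J where "J = integral {a..b} (\<lambda>x. (poly (pderiv q) x)\<^sup>2)"
  have dev: "(poly q x - poly q s)\<^sup>2 \<le> (b - a) * J" if "x \<in> {a..b}" for x
  proof -
    \<comment> \<open>Ordering the two points treats \<open>x\<close> on either side of
      \<open>s\<close> at once.\<close>
    define c d where "c = min x s" and "d = max x s"
    have cd: "c \<le> d" "a \<le> c" "d \<le> b" using that assms by (auto simp: c_def d_def)
    have "(poly q x - poly q s)\<^sup>2 = (poly q d - poly q c)\<^sup>2"
      by (auto simp: c_def d_def min_def max_def power2_commute)
    also have "\<dots> \<le> (d - c) * integral {c..d} (\<lambda>x. (poly (pderiv q) x)\<^sup>2)"
      by (rule poly_increment_square_le) fact
    also have "\<dots> \<le> (b - a) * J"
      unfolding J_def using cd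
      by (intro mult_mono integral_subset_le integral_nonneg) auto
    finally show ?thesis .
  qed
  have "(poly q x)\<^sup>2 \<le> 2 * (poly q s)\<^sup>2 + 2 * ((b - a) * J)" if "x \<in> {a..b}" for x
  proof -
    \<comment> \<open>This square is exactly the gap in the next inequality.\<close>
    have "0 \<le> (poly q x - 2 * poly q s)\<^sup>2" by simp
    then have "(poly q x)\<^sup>2 \<le> 2 * (poly q s)\<^sup>2 + 2 * (poly q x - poly q s)\<^sup>2"
      by (simp add: power2_eq_square algebra_simps)
    with dev[OF that] show ?thesis by linarith
  qed
  then have "integral {a..b} (\<lambda>x. (poly q x)\<^sup>2)
      \<le> integral {a..b} (\<lambda>x. 2 * (poly q s)\<^sup>2 + 2 * ((b - a) * J))"
    by (intro integral_le) auto
  also have "\<dots> = 2 * (b - a) * (poly q s)\<^sup>2 + 2 * (b - a)\<^sup>2 * J"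
    using assms by (simp add: power2_eq_square algebra_simps)
  finally show ?thesis by (simp add: J_def)
qed

section \<open>Summation over the cells around the snapshot points\<close>

lemma integral_split_partition:
  fixes f :: "real \<Rightarrow> real" and t :: "nat \<Rightarrow> real"
  assumes "\<And>i. i < k \<Longrightarrow> t i \<le> t (Suc i)" "f integrable_on {t 0..t k}"
  shows "integral {t 0..t k} f = (\<Sum>i<k. integral {t i..t (Suc i)} f)"
  using assms
proof (induction k)
  case (Suc k)
  have "t 0 \<le> t j" if "j \<le> k" for j
    using that
  proof (induction j)
    case (Suc j)
    then show ?case using Suc.prems \<open>\<And>i. i < Suc k \<Longrightarrow> t i \<le> t (Suc i)\<close>[of j] by simp
  qed simp
  then have le: "t 0 \<le> t k" by simp
  have "t k \<le> t (Suc k)" using Suc.prems(1) by simp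
  have "f integrable_on {t 0..t k}"
    by (rule integrable_on_subinterval[OF Suc.prems(2)]) (use \<open>t k \<le> t (Suc k)\<close> in auto)
  then have "integral {t 0..t k} f = (\<Sum>i<k. integral {t i..t (Suc i)} f)"
    using Suc.IH Suc.prems(1) by simp
  with Henstock_Kurzweil_Integration.integral_combine[OF le \<open>t k \<le> t (Suc k)\<close> Suc.prems(2)]
  show ?case by simp
qed simp

text \<open>The sample point between the breaks \<open>i\<close> and \<open>i + 1\<close> is \<open>ys (i + 1)\<close>.\<close>

definition snapshot_breaks :: "nat \<Rightarrow> (nat \<Rightarrow> real) \<Rightarrow> nat \<Rightarrow> real" where
  "snapshot_breaks N ys i =
     (if i = 0 then -1 else if i = N then 1 else (ys i + ys (Suc i)) / 2)"

lemma snapshot_breaks_bracket: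
  assumes "2 \<le> N" "-1 < ys 1" "\<forall>i\<in>{1..<N}. ys i < ys (i + 1)" "ys N < 1" "i < N"
  shows "snapshot_breaks N ys i \<le> ys (Suc i) \<and> ys (Suc i) \<le> snapshot_breaks N ys (Suc i)"
proof (cases "i = 0")
  case True
  moreover have "ys (Suc 0) < ys (Suc (Suc 0))"
    using assms(1) bspec[OF assms(3), of "Suc 0"] by simp
  ultimately show ?thesis using True assms(1,2) by (auto simp: eval_nat_numeral snapshot_breaks_def)
next
  case False
  have 1: "ys i < ys (Suc i)" using assms(3) assms(5) False by auto
  show ?thesis
  proof (cases "Suc i = N")
    case True
    then show ?thesis using 1 False assms(4) by (auto simp: snapshot_breaks_def)
  next
    case False
    have "ys (Suc i) < ys (Suc (Suc i))" using assms(3) assms(5) False by auto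
    then show ?thesis using 1 False \<open>i \<noteq> 0\<close> assms(5) by (auto simp: snapshot_breaks_def)
  qed
qed

text \<open>Summing the cell estimates gives twice the weighted samples plus
  \<open>2 h\<^sup>2 J\<close>. By the inverse inequality and \<open>2 c h < 1\<close> the latter is
  at most half of the left-hand side; absorbing it doubles the factor 2 to 4.\<close>

lemma integral_poly_square_le_samples:
  fixes q :: "real poly"
  assumes "2 \<le> N" "-1 < ys 1" "\<forall>i\<in>{1..<N}. ys i < ys (i + 1)" "ys N < 1"
    and c: "2 * c * mesh_size N ys < 1" "0 \<le> c"
    and inv: "integral {-1..1} (\<lambda>x. (poly (pderiv q) x)\<^sup>2) \<le> c\<^sup>2 * integral {-1..1} (\<lambda>x. (poly q x)\<^sup>2)"
  shows "integral {-1..1} (\<lambda>x. (poly q x)\<^sup>2)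
    \<le> 4 * (\<Sum>i<N. (snapshot_breaks N ys (Suc i) - snapshot_breaks N ys i) * (poly q (ys (Suc i)))\<^sup>2)"
proof -
  define t where "t = snapshot_breaks N ys"
  define h where "h = mesh_size N ys"
  define J where "J = integral {-1..1} (\<lambda>x. (poly (pderiv q) x)\<^sup>2)"
  define I where "I = integral {-1..1} (\<lambda>x. (poly q x)\<^sup>2)"
  have t0: "t 0 = -1" and tN: "t N = 1" using assms(1) by (auto simp: t_def snapshot_breaks_def)
  have s: "t i \<le> ys (Suc i)" "ys (Suc i) \<le> t (Suc i)" if "i < N" for i
    unfolding t_def using snapshot_breaks_bracket[OF assms(1-4) that] by auto
  have t_le: "t i \<le> t (Suc i)" if "i < N" for i using s[OF that] by linarith
  \<comment> \<open>The outer snapshot intervals are half open, but only their measure enters, so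
    each cell length is one of the terms of the maximum.\<close>
  have width: "t (Suc i) - t i \<le> h" if "i < N" for i
  proof -
    have "t (Suc i) - t i = measure lebesgue (snapshot_interval N ys (Suc i))"
      using t_le[OF that] that assms(1)
      by (auto simp: t_def snapshot_breaks_def snapshot_interval_def eval_nat_numeral split: if_splits)
    also have "\<dots> \<le> h"
      unfolding h_def mesh_size_def using that by (intro Max_ge) auto
    finally show ?thesis .
  qed
  have "0 \<le> t 1 - t 0" using t_le[of 0] assms(1) by simp
  also have "\<dots> \<le> h" using width[of 0] assms(1) by simp
  finally have h0: "0 \<le> h" .
  have J0: "0 \<le> integral {a..b} (\<lambda>x. (poly (pderiv q) x)\<^sup>2)" for a b
    by (rule integral_nonneg) auto
  have I0: "0 \<le> I" unfolding I_def by (rule integral_nonneg) auto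
  have split: "integral {-1..1} (\<lambda>x. (poly p x)\<^sup>2) = (\<Sum>i<N. integral {t i..t (Suc i)} (\<lambda>x. (poly p x)\<^sup>2))"
    for p :: "real poly"
    using integral_split_partition[of N t "\<lambda>x. (poly p x)\<^sup>2"] t_le t0 tN by simp
  have "I = (\<Sum>i<N. integral {t i..t (Suc i)} (\<lambda>x. (poly q x)\<^sup>2))"
    unfolding I_def by (rule split)
  also have "\<dots> \<le> (\<Sum>i<N. 2 * (t (Suc i) - t i) * (poly q (ys (Suc i)))\<^sup>2
      + 2 * h\<^sup>2 * integral {t i..t (Suc i)} (\<lambda>x. (poly (pderiv q) x)\<^sup>2))"
  proof (intro sum_mono)
    fix i assume "i \<in> {..<N}"
    then have i: "i < N" by simp
    have "2 * (t (Suc i) - t i)\<^sup>2 * integral {t i..t (Suc i)} (\<lambda>x. (poly (pderiv q) x)\<^sup>2)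
        \<le> 2 * h\<^sup>2 * integral {t i..t (Suc i)} (\<lambda>x. (poly (pderiv q) x)\<^sup>2)"
      using width[OF i] t_le[OF i] by (intro mult_right_mono mult_left_mono power_mono J0) auto
    then show "integral {t i..t (Suc i)} (\<lambda>x. (poly q x)\<^sup>2) \<le> 2 * (t (Suc i) - t i) * (poly q (ys (Suc i)))\<^sup>2
      + 2 * h\<^sup>2 * integral {t i..t (Suc i)} (\<lambda>x. (poly (pderiv q) x)\<^sup>2)"
      using integral_poly_square_cell[of "t i" "ys (Suc i)" "t (Suc i)" q] s[OF i] by linarith
  qed
  also have "\<dots> = 2 * (\<Sum>i<N. (t (Suc i) - t i) * (poly q (ys (Suc i)))\<^sup>2) + 2 * h\<^sup>2 * J"
    unfolding J_def split by (simp add: sum.distrib sum_distrib_left mult.assoc del: right_diff_distrib_numeral)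
  also have "2 * h\<^sup>2 * J \<le> I / 2"
  proof -
    have "2 * h\<^sup>2 * J \<le> 2 * h\<^sup>2 * (c\<^sup>2 * I)"
      using inv by (intro mult_left_mono) (auto simp: J_def I_def)
    also have "\<dots> = (2 * c * h)\<^sup>2 * (I / 2)" by (simp add: power2_eq_square)
    also have "\<dots> \<le> 1 * (I / 2)"
      using c h0 I0 by (intro mult_right_mono) (auto simp: h_def abs_square_le_1)
    finally show ?thesis by simp
  qed
  finally show ?thesis by (simp add: I_def t_def)
qed

lemma sum_snapshot_breaks:
  assumes "0 < N"
  shows "(\<Sum>i<N. snapshot_breaks N ys (Suc i) - snapshot_breaks N ys i) = 2"
  using assms by (subst sum_lessThan_telescope) (simp add: snapshot_breaks_def)

text \<open>A bridge from the Lebesgue integrals over the open interval to the gauge integrals over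
  the closed one, where the calculus above takes place.\<close>

lemma integral_lebesgue_on_open_interval:
  fixes f :: "real \<Rightarrow> real"
  assumes "continuous_on {a..b} f"
  shows "integrable (lebesgue_on {a<..<b}) f"
    and "(LINT x|lebesgue_on {a<..<b}. f x) = integral {a..b} f"
proof -
  have "f absolutely_integrable_on {a..b}"
    using assms by (rule absolutely_integrable_continuous_real)
  then have "f absolutely_integrable_on {a<..<b}"
    using absolutely_integrable_on_open_interval[of a b f] by simp
  then show *: "integrable (lebesgue_on {a<..<b}) f"
    by (simp add: integrable_restrict_space set_integrable_def)
  show "(LINT x|lebesgue_on {a<..<b}. f x) = integral {a..b} f"
    using lebesgue_integral_eq_integral[OF *] by (simp add: integral_open_interval_real)
qed

lemma L2_norm_poly:
  "L2_norm (lebesgue_on {-1<..<1}) abs (poly q) = sqrt (integral {-1..1} (\<lambda>x. (poly q x)\<^sup>2))"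
  unfolding L2_norm_def
  by (simp, subst integral_lebesgue_on_open_interval) (auto intro!: continuous_intros)

section \<open>Error of the Lagrange subspace\<close>

text \<open>The first two conclusions give square integrability. In the third,
  \<open>20 = 4 + 2 * 8\<close>: integrating \<open>2 \<epsilon>\<close> over length 2 gives 4, and
  twice the bound \<open>8 \<epsilon>\<close> for \<open>u\<close> gives 16.\<close>

lemma (in affine_spd) Lagrange_subspace_error:
  fixes x xt :: "real \<Rightarrow> real^'m" and ys :: "nat \<Rightarrow> real" and N n :: nat
  defines "W \<equiv> span (x ` ys ` {1..N})"
  assumes x: "\<And>y. y \<in> {-1<..<1} \<Longrightarrow> (M + y *\<^sub>R K) *v x y = M *v x0"
    and xt: "\<And>y. y \<in> {-1<..<1} \<Longrightarrow> galerkin W (M *v x0) y (xt y)"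
    and C: "\<And>z. \<bar>z \<bullet> (K *v z)\<bar> \<le> C * (z \<bullet> (M *v z))" "0 \<le> C"
    and ys: "2 \<le> N" "-1 < ys 1" "\<forall>i\<in>{1..<N}. ys i < ys (i + 1)" "ys N < 1"
    and c: "2 * c * mesh_size N ys < 1" "0 \<le> c"
    and inv: "\<And>q::real poly. degree q \<le> n \<Longrightarrow>
      integral {-1..1} (\<lambda>y. (poly (pderiv q) y)\<^sup>2) \<le> c\<^sup>2 * integral {-1..1} (\<lambda>y. (poly q y)\<^sup>2)"
  shows "(\<lambda>y. x y - xt y) \<in> borel_measurable (lebesgue_on {-1<..<1})"
    and "integrable (lebesgue_on {-1<..<1}) (\<lambda>y. (x y - xt y) \<bullet> (M *v (x y - xt y)))"
    and "(LINT y|lebesgue_on {-1<..<1}. (x y - xt y) \<bullet> (M *v (x y - xt y)))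
      \<le> 20 * ((1 + C) / r) * (((1 - r) ^ (n + 1) / r)\<^sup>2 * (x0 \<bullet> (M *v x0)))"
proof -
  have W: "subspace W" unfolding W_def by simp
  have gx: "galerkin UNIV (M *v x0) y (x y)" if "y \<in> {-1<..<1}" for y
    using x[OF that] by (simp add: galerkin_def)
  \<comment> \<open>\<open>q\<close> is the squared energy norm; accordingly
    \<open>\<epsilon>\<close> and \<open>\<kappa>\<close> below are the squares of the norm bound
    and of the quasi-optimality constant.\<close>
  define q where "q z = z \<bullet> (M *v z)" for z
  define \<epsilon> where "\<epsilon> = ((1 - r) ^ (n + 1) / r)\<^sup>2 * q x0"
  obtain F where F: "orthonormal F" "span F = W"
    using ex_orthonormal[of "x ` ys ` {1..N}"] unfolding W_def by auto
  obtain G where G: "orthonormal G" "span G = UNIV"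
    using ex_orthonormal[of Basis] by (auto simp: span_Basis)
  obtain a where a: "\<forall>y v. \<bar>y\<bar> < 1 \<longrightarrow> (M + y *\<^sub>R K) *v v = M *v x0 \<longrightarrow>
      q (v - (\<Sum>k\<le>n. y ^ k *\<^sub>R a k)) \<le> \<epsilon>"
    unfolding q_def \<epsilon>_def using ex_Taylor by blast
  define p where "p y = (\<Sum>k\<le>n. y ^ k *\<^sub>R a k)" for y
  define d where "d k = a k - proj F (a k)" for k
  define u where "u y = p y - proj F (p y)" for y
  have xp: "q (x y - p y) \<le> \<epsilon>" if "y \<in> {-1<..<1}" for y
    unfolding p_def using a x[OF that] that by auto
  have qm: "q (- z) = q z" for z
    using matrix_vector_mult_scaleR[of M "-1" z] by (simp add: q_def)
  have u_eq: "u y = (\<Sum>k\<le>n. y ^ k *\<^sub>R d k)" for y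
    unfolding u_def p_def d_def linear_sum[OF linear_proj] linear_cmul[OF linear_proj]
    by (simp add: scaleR_diff_right sum_subtractf)
  have u_samp: "q (u (ys i)) \<le> \<epsilon>" if "i \<in> {1..N}" "ys i \<in> {-1<..<1}" for i
  proof -
    have "x (ys i) \<in> span F" unfolding F(2) W_def using that by (intro span_base) auto
    then have "proj F (x (ys i)) = x (ys i)" by (rule proj_id[OF F(1)])
    then have "- u (ys i) = (x (ys i) - p (ys i)) - proj F (x (ys i) - p (ys i))"
      by (simp add: u_def linear_diff[OF linear_proj])
    then have "q (u (ys i)) \<le> q (x (ys i) - p (ys i))"
      using norm_diff_proj_le[OF F(1), of "x (ys i) - p (ys i)"] qm[of "u (ys i)"]
      by (simp add: q_def)
    also have "\<dots> \<le> \<epsilon>" by (rule xp) fact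
    finally show ?thesis .
  qed
  \<comment> \<open>The coordinates of \<open>u\<close> along an orthonormal basis are scalar
    polynomials of degree at most \<open>n\<close>; Parseval then carries the sampling inequality
    over to \<open>u\<close>.\<close>
  define P where "P g = (\<Sum>k\<le>n. monom (g \<bullet> (M *v d k)) k)" for g
  have degP: "degree (P g) \<le> n" for g
    unfolding P_def by (intro degree_sum_le) (auto intro: order_trans[OF degree_monom_le])
  have polyP: "poly (P g) y = g \<bullet> (M *v u y)" for g y
    by (simp add: P_def u_eq poly_sum poly_monom linear_sum[OF matrix_vector_mul_linear]
        matrix_vector_mult_scaleR inner_sum_right mult.commute)
  have qu: "q (u y) = (\<Sum>g\<in>G. (poly (P g) y)\<^sup>2)" for y
    using norm_proj(1)[OF G(1), of "u y"] proj_id[OF G(1), of "u y"] G(2)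
    by (simp add: q_def polyP)
  have ys_mono: "ys i \<le> ys j" if "1 \<le> i" "i \<le> j" "j \<le> N" for i j
    using that(2,1,3)
  proof (induction j rule: dec_induct)
    case (step j)
    then have "ys j < ys (j + 1)" using ys(3) by auto
    with step show ?case by simp
  qed simp
  have ys_in: "ys i \<in> {-1<..<1}" if "i \<in> {1..N}" for i
    using ys_mono[of 1 i] ys_mono[of i N] that ys(2,4) by auto
  let ?t = "snapshot_breaks N ys"
  have "integral {-1..1} (\<lambda>y. q (u y)) = (\<Sum>g\<in>G. integral {-1..1} (\<lambda>y. (poly (P g) y)\<^sup>2))"
    unfolding qu using G(1) by (intro integral_sum) (auto simp: orthonormal_def)
  also have "\<dots> \<le> (\<Sum>g\<in>G. 4 * (\<Sum>i<N. (?t (Suc i) - ?t i) * (poly (P g) (ys (Suc i)))\<^sup>2))"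
    by (intro sum_mono integral_poly_square_le_samples[OF ys c] inv degP)
  also have "\<dots> = 4 * (\<Sum>i<N. \<Sum>g\<in>G. (?t (Suc i) - ?t i) * (poly (P g) (ys (Suc i)))\<^sup>2)"
    by (subst sum.swap) (simp add: sum_distrib_left)
  also have "\<dots> = 4 * (\<Sum>i<N. (?t (Suc i) - ?t i) * q (u (ys (Suc i))))"
    by (simp add: qu sum_distrib_left)
  also have "\<dots> \<le> 4 * (\<Sum>i<N. (?t (Suc i) - ?t i) * \<epsilon>)"
    using snapshot_breaks_bracket[OF ys] ys_in
    by (intro mult_left_mono sum_mono u_samp) (auto intro: order_trans)
  \<comment> \<open>The cell lengths add up to 2, the length of the whole interval.\<close>
  also have "\<dots> = 8 * \<epsilon>"
    using sum_snapshot_breaks[of N ys] ys(1) by (simp add: sum_distrib_right[symmetric])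
  finally have int_u: "integral {-1..1} (\<lambda>y. q (u y)) \<le> 8 * \<epsilon>" .
  define \<kappa> where "\<kappa> = (1 + C) / r"
  have \<kappa>0: "0 \<le> \<kappa>" using C(2) r_pos by (simp add: \<kappa>_def)
  have bound: "q (x y - xt y) \<le> \<kappa> * (2 * \<epsilon> + 2 * q (u y))" if "y \<in> {-1<..<1}" for y
  proof -
    have "q (x y - xt y) \<le> \<kappa> * q (x y - proj F (p y))"
      unfolding q_def \<kappa>_def using that proj_in_span[of F "p y"] F(2)
      by (intro galerkin_quasi_optimal[OF W gx[OF that] xt[OF that] _ _ C(1)]) auto
    also have "x y - proj F (p y) = (x y - p y) + u y" by (simp add: u_def)
    also have "q \<dots> \<le> 2 * q (x y - p y) + 2 * q (u y)"
      unfolding q_def by (rule inner_sum_le)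
    also have "\<dots> \<le> 2 * \<epsilon> + 2 * q (u y)" using xp[OF that] by simp
    finally show ?thesis using \<kappa>0 by (simp add: mult_left_mono)
  qed
  have qcont: "continuous_on S (\<lambda>y. q (f y))" if "continuous_on S f" for f :: "real \<Rightarrow> real^'m" and S
    unfolding q_def using that
    by (intro continuous_intros linear_continuous_on_compose[OF _ matrix_vector_mul_linear])
  have ucont: "continuous_on S u" for S
    unfolding u_eq[abs_def] by (intro continuous_intros)
  \<comment> \<open>The solutions are controlled on the open interval only. Integrability of the
    error comes from domination by this function, which is continuous up to the endpoints.\<close>
  have ccont: "continuous_on {-1..1} (\<lambda>y. \<kappa> * (2 * \<epsilon> + 2 * q (u y)))"
    by (intro continuous_intros qcont ucont)
  have cont: "continuous_on {-1<..<1} (\<lambda>y. x y - xt y)"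
    using galerkin_continuous[OF subspace_UNIV gx] galerkin_continuous[OF W xt]
    by (intro continuous_intros) auto
  show "(\<lambda>y. x y - xt y) \<in> borel_measurable (lebesgue_on {-1<..<1})"
    using cont by (rule continuous_imp_measurable_on_sets_lebesgue) simp
  have meas: "(\<lambda>y. q (x y - xt y)) \<in> borel_measurable (lebesgue_on {-1<..<1})"
    using qcont[OF cont] by (rule continuous_imp_measurable_on_sets_lebesgue) simp
  note ci = integral_lebesgue_on_open_interval[OF ccont]
  have int: "integrable (lebesgue_on {-1<..<1}) (\<lambda>y. q (x y - xt y))"
    using bound nonneg
    by (intro Bochner_Integration.integrable_bound[OF ci(1) meas] AE_I2)
      (auto simp: q_def abs_of_nonneg intro: order_trans[OF _ abs_ge_self])
  then show "integrable (lebesgue_on {-1<..<1}) (\<lambda>y. (x y - xt y) \<bullet> (M *v (x y - xt y)))"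
    by (simp add: q_def)
  have "(LINT y|lebesgue_on {-1<..<1}. q (x y - xt y))
      \<le> (LINT y|lebesgue_on {-1<..<1}. \<kappa> * (2 * \<epsilon> + 2 * q (u y)))"
    using bound by (intro integral_mono int ci(1)) auto
  also have "\<dots> = integral {-1..1} (\<lambda>y. \<kappa> * (2 * \<epsilon> + 2 * q (u y)))" by (rule ci(2))
  also have "\<dots> = \<kappa> * (4 * \<epsilon> + 2 * integral {-1..1} (\<lambda>y. q (u y)))"
  proof (rule integral_unique)
    have "((\<lambda>y. q (u y)) has_integral integral {-1..1} (\<lambda>y. q (u y))) {-1..1}"
      by (intro integrable_integral integrable_continuous_real qcont ucont)
    moreover have "((\<lambda>y. 2 * \<epsilon>) has_integral 4 * \<epsilon>) {-1..1::real}"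
      using has_integral_const_real[of "2 * \<epsilon>" "-1" 1] by simp
    ultimately show "((\<lambda>y. \<kappa> * (2 * \<epsilon> + 2 * q (u y))) has_integral
        \<kappa> * (4 * \<epsilon> + 2 * integral {-1..1} (\<lambda>y. q (u y)))) {-1..1}"
      by (intro has_integral_mult_right has_integral_add)
  qed
  also have "\<dots> \<le> \<kappa> * (20 * \<epsilon>)" using int_u \<kappa>0 by (intro mult_left_mono) auto
  finally show "(LINT y|lebesgue_on {-1<..<1}. (x y - xt y) \<bullet> (M *v (x y - xt y)))
      \<le> 20 * ((1 + C) / r) * (((1 - r) ^ (n + 1) / r)\<^sup>2 * (x0 \<bullet> (M *v x0)))"
    by (simp add: q_def \<kappa>_def \<epsilon>_def algebra_simps)
qed

text \<open>Here \<open>\<rho>\<close> stands for \<open>(1 - r) ^ (n + 1)\<close> and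
  \<open>\<theta>\<close> for the denominator in the claimed bound. Both summands of the bracket are
  at least 1, \<open>sqrt 20 \<le> 5\<close>, and \<open>5 / r \<le> 8 / r\<^sup>2\<close> because
  \<open>r < 1\<close>.\<close>

lemma error_constant_le:
  fixes r \<rho> \<theta> \<kappa> :: real
  assumes "0 < r" "r < 1" "0 \<le> \<kappa>" "0 \<le> \<rho>" "0 < \<theta>" "\<theta> \<le> 1"
  shows "sqrt 20 * \<kappa> * (\<rho> / r) \<le> \<kappa> * (sqrt 2 + sqrt (2 * (real n + 1)) / \<theta>) * (4 / r\<^sup>2) * \<rho>"
proof -
  have "sqrt 20 \<le> sqrt (5\<^sup>2)" by (subst real_sqrt_le_iff) simp
  then have s20: "sqrt 20 \<le> 5" by simp
  have "1 \<le> sqrt (2 * (real n + 1))" by simp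
  also have "\<dots> \<le> sqrt (2 * (real n + 1)) / \<theta>"
    using assms by (simp add: le_divide_eq mult_left_le)
  finally have B: "2 \<le> sqrt 2 + sqrt (2 * (real n + 1)) / \<theta>"
    using real_sqrt_ge_one[of 2] by linarith
  have "5 / r \<le> 8 / r\<^sup>2"
    using assms by (simp add: power2_eq_square field_simps)
  have "sqrt 20 * \<kappa> * (\<rho> / r) = (\<kappa> * \<rho>) * (sqrt 20 / r)" by simp
  also have "\<dots> \<le> (\<kappa> * \<rho>) * (8 / r\<^sup>2)"
  proof (intro mult_left_mono mult_nonneg_nonneg)
    have "sqrt 20 / r \<le> 5 / r" using s20 assms(1) by (intro divide_right_mono) auto
    then show "sqrt 20 / r \<le> 8 / r\<^sup>2" using \<open>5 / r \<le> 8 / r\<^sup>2\<close> by linarith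
  qed (use assms in auto)
  also have "\<dots> = (\<kappa> * \<rho>) * ((4 / r\<^sup>2) * 2)" by simp
  also have "\<dots> \<le> (\<kappa> * \<rho>) * ((4 / r\<^sup>2) * (sqrt 2 + sqrt (2 * (real n + 1)) / \<theta>))"
    using assms B by (intro mult_left_mono) auto
  finally show ?thesis by (simp add: mult_ac)
qed

section \<open>Stiffness matrices and subspace solutions\<close>

lemma finite_combination_in_subspace:
  assumes "function_subspace X" "\<And>i. i \<in> F \<Longrightarrow> \<phi> i \<in> X" "finite F"
  shows "(\<lambda>x. \<Sum>i\<in>F. c i * \<phi> i x) \<in> X"
  using assms(3,2)
proof (induction F rule: finite_induct)
  case empty
  then show ?case using assms(1) by (simp add: function_subspace_def)
next
  case (insert i F)
  then have "(\<lambda>x. c i * \<phi> i x) \<in> X" "(\<lambda>x. \<Sum>i\<in>F. c i * \<phi> i x) \<in> X"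
    using assms(1) by (auto simp: function_subspace_def)
  moreover have "(\<lambda>x. u x + v x) \<in> X" if "u \<in> X" "v \<in> X" for u v
    using assms(1) that by (simp add: function_subspace_def)
  ultimately have "(\<lambda>x. c i * \<phi> i x + (\<Sum>i\<in>F. c i * \<phi> i x)) \<in> X" by simp
  then show ?case using insert.hyps by simp
qed

text \<open>\<open>H\<close> is not assumed closed under sums; the partial sums stay in the subspace
  \<open>X\<close>, hence in \<open>H\<close>, where the form is additive.\<close>

lemma form_finite_combination:
  assumes a: "symmetric_bilinear_on H a" and X: "function_subspace X" "X \<subseteq> H"
    and \<phi>: "\<And>i. i \<in> F \<Longrightarrow> \<phi> i \<in> X" and z: "z \<in> H" and "finite F"
  shows "a (\<lambda>x. \<Sum>i\<in>F. c i * \<phi> i x) z = (\<Sum>i\<in>F. c i * a (\<phi> i) z)"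
proof -
  have add: "a (\<lambda>x. u x + v x) z = a u z + a v z" if "u \<in> H" "v \<in> H" for u v
    using a z that unfolding symmetric_bilinear_on_def by blast
  have scale: "a (\<lambda>x. c * u x) z = c * a u z" if "u \<in> H" for c u
    using a z that unfolding symmetric_bilinear_on_def by blast
  show ?thesis
    using \<open>finite F\<close> \<phi>
  proof (induction F rule: finite_induct)
    case empty
    have "(\<lambda>_. 0) \<in> H" using X by (auto simp: function_subspace_def)
    from scale[OF this, of 0] show ?case by simp
  next
    case (insert i F)
    let ?s = "\<lambda>x. \<Sum>i\<in>F. c i * \<phi> i x"
    have i: "\<phi> i \<in> H" using insert.prems X(2) by auto
    have 1: "(\<lambda>x. c i * \<phi> i x) \<in> H"
      using insert.prems X by (auto simp: function_subspace_def)
    have 2: "?s \<in> H"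
      using finite_combination_in_subspace[OF X(1), of F \<phi> c] insert X(2) by auto
    have "a (\<lambda>x. \<Sum>i\<in>insert i F. c i * \<phi> i x) z = a (\<lambda>x. c i * \<phi> i x + ?s x) z"
      using insert.hyps by simp
    also have "\<dots> = a (\<lambda>x. c i * \<phi> i x) z + a ?s z"
      by (rule add[OF 1 2])
    also have "a (\<lambda>x. c i * \<phi> i x) z = c i * a (\<phi> i) z"
      by (rule scale[OF i])
    finally show ?case using insert by simp
  qed
qed

text \<open>Linearity in the second argument comes from symmetry. The identity turns hypotheses on
  the forms into hypotheses on the matrices.\<close>

lemma inner_form_matrix:
  fixes \<phi> :: "'m::finite \<Rightarrow> 'a \<Rightarrow> real"
  assumes a: "symmetric_bilinear_on H a" and X: "function_subspace X" "X \<subseteq> H"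
    and \<phi>: "\<And>i. \<phi> i \<in> X"
  shows "u \<bullet> (form_matrix a \<phi> *v v) =
    a (\<lambda>x. \<Sum>i\<in>UNIV. u $ i * \<phi> i x) (\<lambda>x. \<Sum>i\<in>UNIV. v $ i * \<phi> i x)"
proof -
  let ?v = "\<lambda>x. \<Sum>i\<in>UNIV. v $ i * \<phi> i x"
  have v: "?v \<in> H" using finite_combination_in_subspace[OF X(1), of UNIV \<phi>] \<phi> X(2) by auto
  have \<phi>H: "\<phi> i \<in> H" for i using \<phi> X(2) by auto
  have sym: "a f g = a g f" if "f \<in> H" "g \<in> H" for f g
    using a that unfolding symmetric_bilinear_on_def by blast
  have "a (\<lambda>x. \<Sum>i\<in>UNIV. u $ i * \<phi> i x) ?v = (\<Sum>i\<in>UNIV. u $ i * a (\<phi> i) ?v)"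
    by (rule form_finite_combination[OF a X \<phi> v]) simp
  also have "\<dots> = (\<Sum>i\<in>UNIV. u $ i * (\<Sum>j\<in>UNIV. v $ j * a (\<phi> i) (\<phi> j)))"
  proof (intro sum.cong refl arg_cong[where f = "\<lambda>t. u $ _ * t"])
    fix i
    have "a (\<phi> i) ?v = a ?v (\<phi> i)" by (rule sym[OF \<phi>H v])
    also have "\<dots> = (\<Sum>j\<in>UNIV. v $ j * a (\<phi> j) (\<phi> i))"
      by (rule form_finite_combination[OF a X \<phi> \<phi>H]) simp
    finally show "a (\<phi> i) ?v = (\<Sum>j\<in>UNIV. v $ j * a (\<phi> i) (\<phi> j))"
      using sym[OF \<phi>H \<phi>H] by simp
  qed
  finally show ?thesis
    by (simp add: inner_vec_def matrix_vector_mult_def form_matrix_def mult.commute)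
qed

lemma form_matrix_symmetric:
  assumes "symmetric_bilinear_on H a" "\<And>i. \<phi> i \<in> H"
  shows "transpose (form_matrix a \<phi>) = form_matrix a \<phi>"
  using assms by (auto simp: transpose_def form_matrix_def symmetric_bilinear_on_def vec_eq_iff)

text \<open>A function that is not zero almost everywhere has positive \<open>L\<^sup>2\<close>
  norm, and the \<open>H\<^sup>1\<close> norm dominates it.\<close>

lemma coercive_form_pos:
  assumes a: "coercive_on (H10 \<Omega>) (H1_norm \<Omega>) a" and u: "u \<in> H10 \<Omega>"
    and nz: "\<not> (AE x in lebesgue_on \<Omega>. u x = 0)"
  shows "0 < a u u"
proof -
  obtain \<alpha> where \<alpha>: "0 < \<alpha>" "\<alpha> * (H1_norm \<Omega> u)\<^sup>2 \<le> a u u"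
    using a u unfolding coercive_on_def by blast
  let ?I = "LINT x|lebesgue_on \<Omega>. (abs (u x))\<^sup>2"
  have "integrable (lebesgue_on \<Omega>) (\<lambda>x. (abs (u x))\<^sup>2)"
    using u by (simp add: H10_def H1_def L2_space_def)
  then have "?I \<noteq> 0"
    using nz by (subst integral_nonneg_eq_0_iff_AE) auto
  moreover have "0 \<le> ?I" by (rule integral_nonneg_AE) simp
  ultimately have "0 < ?I" by linarith
  also have "?I \<le> (H1_norm \<Omega> u)\<^sup>2"
    using \<open>0 \<le> ?I\<close> by (simp add: H1_norm_def L2_norm_def)
  finally show ?thesis using \<alpha> by (meson less_le_trans mult_pos_pos)
qed

text \<open>The reduced system says that the residual is orthogonal to every column of
  \<open>Q\<close>; by linearity it is orthogonal to their span.\<close>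

lemma subspace_solution_test:
  assumes Q: "basis_matrix Q V" and xt: "subspace_solution Q S b xt"
  shows "xt \<in> V \<and> (\<forall>v\<in>V. v \<bullet> (S *v xt) = v \<bullet> b)"
proof
  obtain z where z: "xt = Q *v z" "(transpose Q ** S ** Q) *v z = transpose Q *v b"
    using xt by (auto simp: subspace_solution_def)
  have V: "V = span (columns Q)" using Q by (simp add: basis_matrix_def)
  show "xt \<in> V" unfolding z V by (rule matrix_vector_mult_in_columnspace)
  have test: "transpose Q *v (S *v xt) = transpose Q *v b"
    using z by (simp add: matrix_vector_mul_assoc matrix_mul_assoc)
  have col: "column j Q \<bullet> v = (transpose Q *v v) $ j" for j v
    by (simp add: inner_vec_def matrix_vector_mult_def transpose_def column_def)
  show "\<forall>v\<in>V. v \<bullet> (S *v xt) = v \<bullet> b"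
  proof
    fix v assume "v \<in> V"
    then have "v \<in> span (columns Q)" by (simp add: V)
    then show "v \<bullet> (S *v xt) = v \<bullet> b"
    proof (induction rule: span_induct)
      case base
      then show ?case by (simp add: subspace_def inner_add_left)
    next
      case (step w)
      then show ?case using test by (auto simp: columns_def col)
    qed
  qed
qed

section \<open>From the model problem to the matrix estimate\<close>

theorem corollary5p2:
  fixes \<Omega> :: "(real^'d) set"
    and L :: "(real^'d \<Rightarrow> real) \<Rightarrow> real"
    and a0 a1 :: "(real^'d \<Rightarrow> real) \<Rightarrow> (real^'d \<Rightarrow> real) \<Rightarrow> real"
    and r C Cinv :: real
    and Xh :: "(real^'d \<Rightarrow> real) set"
    and \<phi> :: "'m::finite \<Rightarrow> real^'d \<Rightarrow> real"
    and A0 A1 :: "real^'m^'m" and A :: "real \<Rightarrow> real^'m^'m" and b :: "real^'m"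
    and n N :: nat and ys w :: "nat \<Rightarrow> real"
    and x xt :: "real \<Rightarrow> real^'m"
    and Q :: "real^'k^'m"
  assumes "CARD('d) \<in> {2, 3}" and "Lipschitz_domain \<Omega>"
    and "bounded_functional_on (H10 \<Omega>) (H1_norm \<Omega>) L"
    and "symmetric_bilinear_on (H10 \<Omega>) a0" and "continuous_form_on (H10 \<Omega>) (H1_norm \<Omega>) a0"
    and "symmetric_bilinear_on (H10 \<Omega>) a1" and "continuous_form_on (H10 \<Omega>) (H1_norm \<Omega>) a1"
    and "coercive_on (H10 \<Omega>) (H1_norm \<Omega>) a0"
    and "\<forall>v\<in>H10 \<Omega>. 0 \<le> a1 v v"
    and "0 < r" and "r < 1" and "\<forall>v\<in>H10 \<Omega>. a1 v v \<le> (1 - r) * a0 v v"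
    and "0 < C" and "\<forall>v\<in>H10 \<Omega>. \<forall>z\<in>H10 \<Omega>. \<bar>a1 v z\<bar> \<le> C * sqrt (a0 v v) * sqrt (a0 z z)"
    and "function_subspace Xh" and "Xh \<subseteq> H10 \<Omega>" and "function_basis (lebesgue_on \<Omega>) Xh \<phi>"
    and "A0 = form_matrix a0 \<phi>" and "A1 = form_matrix a1 \<phi>"
    and "\<forall>y\<in>{-1<..<1}. A y = A0 + y *\<^sub>R A1"
    and "b = load_vector L \<phi>" and "b \<noteq> 0"
    and "0 < Cinv"
    and "\<forall>k (q::real poly). degree q \<le> k \<longrightarrow>
           L2_norm (lebesgue_on {-1<..<1}) abs (poly (pderiv q))
             \<le> Cinv * (real k)\<^sup>2 * L2_norm (lebesgue_on {-1<..<1}) abs (poly q)"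
    and "2 \<le> N"
    and "-1 < ys 1" and "\<forall>i\<in>{1..<N}. ys i < ys (i + 1)" and "ys N < 1"
    and "\<forall>i\<in>{1..N}. 0 < w i"
    and "inner_product_on_polys n (discrete_product N ys w)"
    and "(\<Sum>i=1..N. w i) = 2"
    and "2 * Cinv * mesh_size N ys * (real n)\<^sup>2 < 1"
    and "\<forall>y\<in>{-1<..<1}. A y *v x y = b"
    and "basis_matrix Q (span (x ` ys ` {1..N}))"
    and "\<forall>y\<in>{-1<..<1}. subspace_solution Q (A y) b (xt y)"
  shows "(\<lambda>y. x y - xt y) \<in> L2_space (lebesgue_on {-1<..<1}) (energy_norm A0) \<and>
    L2_norm (lebesgue_on {-1<..<1}) (energy_norm A0) (\<lambda>y. x y - xt y) / energy_norm A0 (x 0)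
      \<le> sqrt ((1 + C) / r) *
         (sqrt 2 + sqrt (2 * (real n + 1)) / (1 - 2 * Cinv * mesh_size N ys * (real n)\<^sup>2)) *
         (4 / r\<^sup>2) * (1 - r) ^ (n + 1)"
proof -
  have sb0: "symmetric_bilinear_on (H10 \<Omega>) a0" and sb1: "symmetric_bilinear_on (H10 \<Omega>) a1"
    and coer: "coercive_on (H10 \<Omega>) (H1_norm \<Omega>) a0"
    and a1_nonneg: "\<forall>v\<in>H10 \<Omega>. 0 \<le> a1 v v"
    and r: "0 < r" "r < 1"
    and a1_le: "\<forall>v\<in>H10 \<Omega>. a1 v v \<le> (1 - r) * a0 v v"
    and C: "0 < C"
    and a1_C: "\<forall>v\<in>H10 \<Omega>. \<forall>z\<in>H10 \<Omega>. \<bar>a1 v z\<bar> \<le> C * sqrt (a0 v v) * sqrt (a0 z z)"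
    and Xh: "function_subspace Xh" "Xh \<subseteq> H10 \<Omega>" and basis: "function_basis (lebesgue_on \<Omega>) Xh \<phi>"
    by (fact assms)+
  have A0: "A0 = form_matrix a0 \<phi>" and A1: "A1 = form_matrix a1 \<phi>" by (fact assms)+
  have A: "\<And>y. y \<in> {-1<..<1} \<Longrightarrow> A y = A0 + y *\<^sub>R A1"
    and b: "b \<noteq> 0" and Cinv: "0 < Cinv"
    and inv: "\<And>k (q::real poly). degree q \<le> k \<Longrightarrow>
           L2_norm (lebesgue_on {-1<..<1}) abs (poly (pderiv q))
             \<le> Cinv * (real k)\<^sup>2 * L2_norm (lebesgue_on {-1<..<1}) abs (poly q)"
    and ys: "2 \<le> N" "-1 < ys 1" "\<forall>i\<in>{1..<N}. ys i < ys (i + 1)" "ys N < 1"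
    and mesh: "2 * Cinv * mesh_size N ys * (real n)\<^sup>2 < 1"
    and x: "\<And>y. y \<in> {-1<..<1} \<Longrightarrow> A y *v x y = b"
    and Q: "basis_matrix Q (span (x ` ys ` {1..N}))"
    and xt: "\<And>y. y \<in> {-1<..<1} \<Longrightarrow> subspace_solution Q (A y) b (xt y)"
    using assms by blast+
  \<comment> \<open>The finite element function with coefficient vector \<open>z\<close>.\<close>
  define f where "f z = (\<lambda>s. \<Sum>i\<in>UNIV. z $ i * \<phi> i s)" for z :: "real^'m"
  have \<phi>: "\<phi> i \<in> Xh" for i using basis by (simp add: function_basis_def)
  then have \<phi>H: "\<phi> i \<in> H10 \<Omega>" for i using Xh by auto
  have fH: "f z \<in> H10 \<Omega>" for z
    using finite_combination_in_subspace[OF Xh(1), of UNIV \<phi> "\<lambda>i. z $ i"] \<phi> Xh(2)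
    by (auto simp: f_def)
  have A0f: "u \<bullet> (A0 *v v) = a0 (f u) (f v)" for u v
    unfolding A0 f_def by (rule inner_form_matrix[OF sb0 Xh \<phi>])
  have A1f: "u \<bullet> (A1 *v v) = a1 (f u) (f v)" for u v
    unfolding A1 f_def by (rule inner_form_matrix[OF sb1 Xh \<phi>])
  interpret affine_spd A0 A1 r
  proof
    show "transpose A0 = A0" unfolding A0 by (rule form_matrix_symmetric[OF sb0 \<phi>H])
    show "transpose A1 = A1" unfolding A1 by (rule form_matrix_symmetric[OF sb1 \<phi>H])
    fix z :: "real^'m"
    show "0 \<le> z \<bullet> (A1 *v z)" using a1_nonneg fH by (simp add: A1f)
    show "z \<bullet> (A1 *v z) \<le> (1 - r) * (z \<bullet> (A0 *v z))" using a1_le fH by (simp add: A1f A0f)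
    assume "z \<noteq> 0"
    \<comment> \<open>Independence modulo null sets is what makes \<open>A0\<close>
      definite.\<close>
    have "\<not> (AE s in lebesgue_on \<Omega>. f z s = 0)"
    proof
      assume "AE s in lebesgue_on \<Omega>. f z s = 0"
      then have "\<forall>i. z $ i = 0" using basis unfolding function_basis_def f_def by blast
      with \<open>z \<noteq> 0\<close> show False by (simp add: vec_eq_iff)
    qed
    then show "0 < z \<bullet> (A0 *v z)" unfolding A0f by (rule coercive_form_pos[OF coer fH])
  qed (use r in auto)
  \<comment> \<open>At \<open>y = 0\<close> the system matrix is \<open>A0\<close>, so the load
    takes the form \<open>M *v x0\<close> with \<open>x0 = x 0\<close>; this brings in the
    normalisation by \<open>x 0\<close>.\<close>
  have b_eq: "b = A0 *v x 0" using x[of 0] A[of 0] by simp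
  have sys: "(A0 + y *\<^sub>R A1) *v x y = A0 *v x 0" if "y \<in> {-1<..<1}" for y
    using x[OF that] A[OF that] b_eq by simp
  have gal: "galerkin (span (x ` ys ` {1..N})) (A0 *v x 0) y (xt y)" if "y \<in> {-1<..<1}" for y
    using subspace_solution_test[OF Q xt[OF that]] A[OF that] b_eq by (simp add: galerkin_def)
  have A1_C: "\<bar>z \<bullet> (A1 *v z)\<bar> \<le> C * (z \<bullet> (A0 *v z))" for z
  proof -
    have "\<bar>z \<bullet> (A1 *v z)\<bar> \<le> C * sqrt (a0 (f z) (f z)) * sqrt (a0 (f z) (f z))"
      unfolding A1f using a1_C fH by blast
    then show ?thesis using nonneg[of z] by (simp add: A0f mult.assoc)
  qed
  define c where "c = Cinv * (real n)\<^sup>2"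
  have c0: "0 \<le> c" and c1: "2 * c * mesh_size N ys < 1"
    using Cinv mesh by (simp_all add: c_def mult_ac)
  have invc: "integral {-1..1} (\<lambda>y. (poly (pderiv q) y)\<^sup>2) \<le> c\<^sup>2 * integral {-1..1} (\<lambda>y. (poly q y)\<^sup>2)"
    if "degree q \<le> n" for q :: "real poly"
  proof -
    have "sqrt (integral {-1..1} (\<lambda>y. (poly (pderiv q) y)\<^sup>2)) \<le> c * sqrt (integral {-1..1} (\<lambda>y. (poly q y)\<^sup>2))"
      using inv[OF that] by (simp add: L2_norm_poly c_def)
    also have "\<dots> = sqrt (c\<^sup>2 * integral {-1..1} (\<lambda>y. (poly q y)\<^sup>2))"
      using c0 by (simp add: real_sqrt_mult)
    finally show ?thesis by simp
  qed
  note err = Lagrange_subspace_error[OF sys gal A1_C less_imp_le[OF C] ys c1 c0 invc]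
  have en: "(energy_norm A0 z)\<^sup>2 = z \<bullet> (A0 *v z)" for z
    using nonneg[of z] by (simp add: energy_norm_def)
  \<comment> \<open>Needed for the denominator of the claimed bound to be at most 1.\<close>
  have mesh0: "0 \<le> mesh_size N ys"
    unfolding mesh_size_def using ys(1)
    by (intro order_trans[OF measure_nonneg Max_ge[of _ "measure lebesgue (snapshot_interval N ys 1)"]]) auto
  have "x 0 \<noteq> 0" using b b_eq by auto
  then have x0: "0 < energy_norm A0 (x 0)" using pos by (simp add: energy_norm_def)
  have "L2_norm (lebesgue_on {-1<..<1}) (energy_norm A0) (\<lambda>y. x y - xt y)
      \<le> sqrt (20 * ((1 + C) / r) * (((1 - r) ^ (n + 1) / r)\<^sup>2 * (energy_norm A0 (x 0))\<^sup>2))"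
    unfolding L2_norm_def en by (rule real_sqrt_le_mono[OF err(3)])
  also have "\<dots> = sqrt 20 * sqrt ((1 + C) / r) * ((1 - r) ^ (n + 1) / r) * energy_norm A0 (x 0)"
    using x0 r by (simp only: real_sqrt_mult real_sqrt_abs) simp
  finally have "L2_norm (lebesgue_on {-1<..<1}) (energy_norm A0) (\<lambda>y. x y - xt y) / energy_norm A0 (x 0)
      \<le> sqrt 20 * sqrt ((1 + C) / r) * ((1 - r) ^ (n + 1) / r)"
    using x0 by (simp add: pos_divide_le_eq)
  also have "\<dots> \<le> sqrt ((1 + C) / r) *
      (sqrt 2 + sqrt (2 * (real n + 1)) / (1 - 2 * Cinv * mesh_size N ys * (real n)\<^sup>2)) *
      (4 / r\<^sup>2) * (1 - r) ^ (n + 1)"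
    using r C Cinv mesh mesh0 by (intro error_constant_le) auto
  finally show ?thesis
    using err(1,2) by (simp add: L2_space_def en)
qed

end
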